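(* Let $H=\left(\bigcup_{i\in I_1}P_{2\ell_i}\right)\cup\left(\bigcup_{j\in I_2}P_{2\ell_j+1}\right)$ be a linear forest with $|I_1|+|I_2|=k\geq 2$ components, where $\ell_i\geq 2$ for $i\in I_1$ and $\ell_j\geq 1$ for $j\in I_2$, and let $\ell=\sum_{i=1}^k\ell_i$. Assume $H\neq kP_3$. Let $F$ be a graph with $\chi(F)\geq 3$ and $\beta_1(F)\geq 2$. Then there is $N=N(H,F)$ such that for all $n\geq N$: (i) if $I_1\neq\emptyset$, then $ex(n,\{H,F\})=(\ell-1)(n-\ell+1)+ex(\ell-1,\mathscr{G}_1(F))$; (ii) if $I_1=\emptyset$, then $ex(n,\{H,F\})=(\ell-1)(n-\ell+1)+\max\{ex(\ell-1,\mathscr{G}_1(F)),\ ex(\ell-1,\mathscr{G}_2(F))+1\}$.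
   Context: All graphs are finite and simple. $ex(n,\mathscr{F})$ is the maximum number of edges of an $n$-vertex graph containing no member of $\mathscr{F}$ as a subgraph. $P_m$ is the path on $m$ vertices; the components of $H$ are pairwise vertex-disjoint paths indexed by $I_1\cup I_2$ ($I_1$ the even paths, $I_2$ the odd paths). $\chi$ is the chromatic number. An edge control set of $F$ is a set $E'\subseteq E(F)$ such that every edge not in $E'$ shares an endpoint with an edge of $E'$; $\beta_1(F)$ is the minimum size of such a set. $\mathscr{G}_1(F)=\{F[V(F)\setminus S]: S\subseteq V(F),\ e(F[S])=0\}$ and $\mathscr{G}_2(F)=\{F[V(F)\setminus S]: S\subseteq V(F),\ e(F[S])\leq 1\}$. *)

theory Defs
  imports Main "HOL-Library.Extended_Real"
begin

type_synonym graph = "nat set \<times> nat set set"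

definition verts :: "graph \<Rightarrow> nat set" where "verts G = fst G"
definition edges :: "graph \<Rightarrow> nat set set" where "edges G = snd G"

definition wf_graph :: "graph \<Rightarrow> bool" where
  "wf_graph G \<longleftrightarrow> finite (verts G) \<and>
     (\<forall>e\<in>edges G. \<exists>u v. u \<noteq> v \<and> e = {u, v} \<and> u \<in> verts G \<and> v \<in> verts G)"

definition contains :: "graph \<Rightarrow> graph \<Rightarrow> bool" where
  "contains G F \<longleftrightarrow> (\<exists>f. inj_on f (verts F) \<and> f ` verts F \<subseteq> verts G \<and>
     (\<forall>e\<in>edges F. f ` e \<in> edges G))"

text \<open>Turan number; the supremum of the empty set is -infinity (no admissible graph).\<close>
definition ex :: "nat \<Rightarrow> graph set \<Rightarrow> ereal" where
  "ex n Fs = Sup {ereal (real (card E)) | E. wf_graph ({0..<n}, E) \<and>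
                   (\<forall>F\<in>Fs. \<not> contains ({0..<n}, E) F)}"

definition induced :: "graph \<Rightarrow> nat set \<Rightarrow> graph" where
  "induced G S = (S, {e\<in>edges G. e \<subseteq> S})"

definition num_edges_in :: "graph \<Rightarrow> nat set \<Rightarrow> nat" where
  "num_edges_in G S = card {e\<in>edges G. e \<subseteq> S}"

definition G1 :: "graph \<Rightarrow> graph set" where
  "G1 F = {induced F (verts F - S) | S. S \<subseteq> verts F \<and> num_edges_in F S = 0}"

definition G2 :: "graph \<Rightarrow> graph set" where
  "G2 F = {induced F (verts F - S) | S. S \<subseteq> verts F \<and> num_edges_in F S \<le> 1}"

definition chromatic :: "graph \<Rightarrow> nat" where
  "chromatic G = (LEAST k. \<exists>c::nat \<Rightarrow> nat. (\<forall>v\<in>verts G. c v < k) \<and>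
      (\<forall>u v. {u, v} \<in> edges G \<longrightarrow> u \<noteq> v \<longrightarrow> c u \<noteq> c v))"

definition edge_control_set :: "graph \<Rightarrow> nat set set \<Rightarrow> bool" where
  "edge_control_set G E' \<longleftrightarrow> E' \<subseteq> edges G \<and>
     (\<forall>e\<in>edges G - E'. \<exists>e'\<in>E'. e \<inter> e' \<noteq> {})"

definition beta1 :: "graph \<Rightarrow> nat" where
  "beta1 G = (LEAST c. \<exists>E'. edge_control_set G E' \<and> card E' = c)"

text \<open>Linear forest with k components; component i is the path on m i vertices,
  occupying vertices off i, ..., off i + m i - 1.\<close>
definition lf_offset :: "(nat \<Rightarrow> nat) \<Rightarrow> nat \<Rightarrow> nat" where
  "lf_offset m i = (\<Sum>j<i. m j)"

definition linear_forest :: "nat \<Rightarrow> (nat \<Rightarrow> nat) \<Rightarrow> graph" where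
  "linear_forest k m = ({0..<(\<Sum>j<k. m j)},
     {{lf_offset m i + j, lf_offset m i + j + 1} | i j. i < k \<and> j + 1 < m i})"

end

theory Submission
  imports Defs
begin

text \<open>Let \<open>s = l - 1\<close>. A forest-free graph with at least \<open>s (n - s)\<close> edges contains, for large \<open>n\<close>, a set
  \<open>A\<close> of \<open>s\<close> vertices with arbitrarily many common neighbours (stability). A copy of the forest can
  be built as soon as one of its paths uses fewer vertices of \<open>A\<close> than half its order, because the
  remaining paths can alternate between \<open>A\<close> and its common neighbourhood. This forces the vertices
  outside \<open>A\<close> to carry on average at most \<open>s\<close> edges each, with one exceptional edge between two
  common neighbours of \<open>A\<close>, possible only if all paths are odd. Since the common neighbourhood is
  large, \<open>A\<close> induces a graph free of \<open>G1 F\<close>, and of \<open>G2 F\<close> if the exceptional edge exists. The lower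
  bound comes from joining an extremal graph on \<open>s\<close> vertices to an independent set, plus one edge in
  the odd case.\<close>

section \<open>Edge counts and long paths\<close>

text \<open>The obstacle is half an edge per vertex. Removing components one by one, with the
  Erdos-Gallai bound at the end, shows only that a forest-free graph has at most (l - 1/2) n + O(1)
  edges, while the target is (l - 1) n + O(1). This is why edge counts are doubled, and why
  stability applies that weak bound to the forest without one component: the half that is lost there
  still leaves a surplus of n/2 edges. Until \<open>A\<close> is found, each component is replaced
  by the odd path with the same half-length: it contains the original one and can be built from
  equally many vertices of \<open>A\<close>. Parity matters only afterwards. For kP3 the formula
  fails: a matching outside a complete core of k - 1 vertices creates no kP3. A component of even
  order or of order at least 5 rules such matchings out. The condition chi(F) >= 3 says that F minus
  an independent set always keeps an edge. So ex(l - 1, G1 F) is at least 0, and graphs with fewer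
  than s (n - s) edges obey the upper bound without any structure.\<close>

definition edge_set :: "'a set set \<Rightarrow> bool" where
  "edge_set E \<longleftrightarrow> (\<forall>e\<in>E. \<exists>u v. u \<noteq> v \<and> e = {u, v})"

definition adj :: "'a set set \<Rightarrow> 'a \<Rightarrow> 'a \<Rightarrow> bool" where
  "adj E x y \<longleftrightarrow> {x, y} \<in> E"

definition ecount :: "'a set set \<Rightarrow> 'a set \<Rightarrow> nat" where
  "ecount E S = card {e \<in> E. e \<subseteq> S}"

definition deg :: "'a set set \<Rightarrow> 'a \<Rightarrow> 'a set \<Rightarrow> nat" where
  "deg E v S = card {u \<in> S. adj E v u}"

definition is_path :: "'a set set \<Rightarrow> 'a list \<Rightarrow> bool" where
  "is_path E p \<longleftrightarrow> distinct p \<and> successively (adj E) p"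

lemma adj_sym: "adj E x y \<longleftrightarrow> adj E y x"
  by (simp add: adj_def insert_commute)

lemma adj_neq: "edge_set E \<Longrightarrow> adj E x y \<Longrightarrow> x \<noteq> y"
  by (auto simp: adj_def edge_set_def)

lemma ecount_empty [simp]: "edge_set E \<Longrightarrow> ecount E {} = 0"
  by (auto simp: ecount_def edge_set_def)

lemma deg_le: "finite S \<Longrightarrow> deg E v S \<le> card S"
  by (auto simp: deg_def intro: card_mono)

lemma deg_mono: "finite T \<Longrightarrow> S \<subseteq> T \<Longrightarrow> deg E v S \<le> deg E v T"
  by (auto simp: deg_def intro!: card_mono)

lemma ecount_insert:
  assumes "edge_set E" "finite S" "v \<notin> S"
  shows "ecount E (insert v S) = ecount E S + deg E v S"
proof -
  have eq: "{e \<in> E. e \<subseteq> insert v S} = {e \<in> E. e \<subseteq> S} \<union> (\<lambda>u. {v, u}) ` {u \<in> S. adj E v u}"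
    (is "?L = ?R")
  proof
    show "?L \<subseteq> ?R"
    proof
      fix e assume e: "e \<in> ?L"
      then obtain x y where xy: "x \<noteq> y" "e = {x, y}" using assms(1) by (auto simp: edge_set_def)
      show "e \<in> ?R"
      proof (cases "v \<in> e")
        case True
        then obtain u where "e = {v, u}" "u \<noteq> v" using xy by auto
        with e show ?thesis by (auto simp: adj_def)
      next
        case False with e show ?thesis by auto
      qed
    qed
    show "?R \<subseteq> ?L" using assms by (auto simp: adj_def)
  qed
  have "finite {e \<in> E. e \<subseteq> S}" by (rule finite_subset[of _ "Pow S"]) (use assms in auto)
  moreover have "{e \<in> E. e \<subseteq> S} \<inter> (\<lambda>u. {v, u}) ` {u \<in> S. adj E v u} = {}" using assms by auto
  moreover have "inj_on (\<lambda>u. {v, u}) {u \<in> S. adj E v u}"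
    using assms by (auto simp: inj_on_def doubleton_eq_iff)
  ultimately show ?thesis
    unfolding ecount_def deg_def eq using assms(2) by (subst card_Un_disjoint) (auto simp: card_image)
qed

lemma deg_union:
  assumes "finite A" "finite B" "A \<inter> B = {}"
  shows "deg E v (A \<union> B) = deg E v A + deg E v B"
proof -
  have "{u \<in> A \<union> B. adj E v u} = {u \<in> A. adj E v u} \<union> {u \<in> B. adj E v u}" by auto
  then show ?thesis unfolding deg_def using assms by (subst card_Un_disjoint[symmetric]) auto
qed

lemma ecount_union:
  assumes "edge_set E" "finite A" "finite B" "A \<inter> B = {}"
  shows "ecount E (A \<union> B) = ecount E A + ecount E B + (\<Sum>b\<in>B. deg E b A)"
  using assms(3,4)
proof (induction B)
  case empty
  then show ?case using assms by simp
next
  case (insert b B)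
  then have "ecount E (A \<union> insert b B) = ecount E (A \<union> B) + deg E b (A \<union> B)"
    using ecount_insert[of E "A \<union> B" b] assms by simp
  then show ?case using insert assms ecount_insert[of E B b] deg_union[of A B E b] by simp
qed

lemma deg_insert_self: "edge_set E \<Longrightarrow> deg E v (insert v S) = deg E v S"
  using adj_neq[of E v v] by (auto simp: deg_def intro: arg_cong[of _ _ card])

lemma handshake:
  assumes "edge_set E" "finite S"
  shows "(\<Sum>v\<in>S. deg E v S) = 2 * ecount E S"
  using assms(2)
proof (induction S)
  case empty
  then show ?case using assms by simp
next
  case (insert v S)
  have "(\<Sum>u\<in>S. deg E u (insert v S)) = (\<Sum>u\<in>S. deg E u S + (if adj E v u then 1 else 0))"
  proof (rule sum.cong)
    fix u assume "u \<in> S"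
    have "{w \<in> insert v S. adj E u w} = {w \<in> S. adj E u w} \<union> (if adj E v u then {v} else {})"
      using adj_sym[of E u v] by auto
    then show "deg E u (insert v S) = deg E u S + (if adj E v u then 1 else 0)"
      using insert by (auto simp: deg_def)
  qed simp
  also have "\<dots> = (\<Sum>u\<in>S. deg E u S) + deg E v S"
    using insert(1) by (simp add: sum.distrib deg_def sum.If_cases Int_def)
  finally show ?case
    using insert ecount_insert[OF assms(1) insert(1,2)] by (simp add: deg_insert_self[OF assms(1)])
qed

lemma deg_less_card: "edge_set E \<Longrightarrow> finite S \<Longrightarrow> v \<in> S \<Longrightarrow> deg E v S < card S"
  unfolding deg_def using adj_neq[of E v v] by (intro psubset_card_mono) auto

lemma is_path_take: "is_path E p \<Longrightarrow> is_path E (take j p)"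
  by (metis append_take_drop_id distinct_append is_path_def successively_append_iff)

lemma ecount_le_square:
  assumes "edge_set E" "finite S"
  shows "2 * ecount E S \<le> card S * (card S - 1)"
proof -
  have "(\<Sum>v\<in>S. deg E v S) \<le> (\<Sum>v\<in>S. card S - 1)"
    by (rule sum_mono) (use deg_less_card[OF assms] in fastforce)
  then show ?thesis using handshake[OF assms] by simp
qed

section \<open>Rotating cycles, closing longest paths and the Erdos-Gallai bound\<close>

lemma is_path_rotate:
  assumes "is_path E (c1 @ y # c2)" "adj E (last (c1 @ y # c2)) (hd (c1 @ y # c2))"
  shows "is_path E (y # c2 @ c1)"
proof (cases "c1 = []")
  case False
  then show ?thesis using assms
    by (auto simp: is_path_def successively_append_iff successively_Cons split: if_splits)
qed (use assms in simp)

text \<open>Follow \<open>p\<close> up to position i, jump to its last vertex and walk back to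
  position i + 1, which is joined to the start. The result closes up to a cycle on the same
  vertices.\<close>

lemma path_crossing:
  assumes "is_path E p" "i + 1 < length p" "adj E (p ! 0) (p ! (i + 1))" "adj E (last p) (p ! i)"
  defines "c \<equiv> take (i + 1) p @ rev (drop (i + 1) p)"
  shows "is_path E c" "set c = set p" "adj E (last c) (hd c)" "length c = length p"
proof -
  let ?a = "take (i + 1) p" and ?b = "drop (i + 1) p"
  have ne: "?a \<noteq> []" "?b \<noteq> []" using assms by auto
  have ab: "p = ?a @ ?b" by simp
  have suc: "successively (adj E) ?a" "successively (adj E) ?b"
    using assms(1) ab unfolding is_path_def by (metis successively_append_iff)+
  have "successively (adj E) (rev ?b)"
    using suc(2) by (simp add: adj_sym[of E] successively_rev)
  moreover have "last ?a = p ! i" using assms by (simp add: take_Suc_conv_app_nth)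
  moreover have "hd (rev ?b) = last p" using ne by (simp add: hd_rev last_drop)
  ultimately have "successively (adj E) c"
    using suc(1) assms(4) adj_sym[of E] unfolding c_def by (auto simp: successively_append_iff)
  moreover have "distinct c"
    using assms(1) ab unfolding c_def is_path_def
    by (metis distinct_append distinct_rev set_rev)
  ultimately show "is_path E c" by (simp add: is_path_def)
  show "set c = set p" using ab unfolding c_def by (metis set_append set_rev)
  have "last c = p ! (i + 1)" unfolding c_def using ne assms by (simp add: last_rev hd_drop_conv_nth)
  moreover have "hd c = p ! 0" unfolding c_def using ne assms by (cases p) auto
  ultimately show "adj E (last c) (hd c)" using assms(3) adj_sym by metis
  show "length c = length p" unfolding c_def using assms(2) by simp
qed

lemma longest_path_exists:
  assumes "finite S" "S \<noteq> {}"
  obtains p where "is_path E p" "set p \<subseteq> S" "p \<noteq> []"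
    "\<And>q. is_path E q \<Longrightarrow> set q \<subseteq> S \<Longrightarrow> length q \<le> length p"
proof -
  obtain x where x: "x \<in> S" using assms by auto
  let ?P = "\<lambda>p. is_path E p \<and> set p \<subseteq> S"
  have bd: "length q < card S + 1" if "?P q" for q
    using that assms card_mono[of S "set q"] by (auto simp: is_path_def distinct_card)
  have P1: "?P [x]" using x by (auto simp: is_path_def)
  from ex_has_greatest_nat[of ?P "[x]" length "card S + 1", OF P1] bd
  obtain p where p: "?P p" "\<forall>q. ?P q \<longrightarrow> length q \<le> length p" by (meson less_imp_le_nat)
  with P1 have "p \<noteq> []" by force
  with p show thesis using that by blast
qed

text \<open>In a longest path, a crossing of the neighbourhoods of the two ends turns its vertex set into
  a cycle, which by maximality spans a union of components.\<close>

lemma erdos_gallai: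
  assumes "edge_set E" "finite S" "t \<ge> 2"
    and "\<And>p. is_path E p \<Longrightarrow> set p \<subseteq> S \<Longrightarrow> length p \<noteq> t"
  shows "2 * ecount E S \<le> (t - 2) * card S"
  using assms(2,4)
proof (induction "card S" arbitrary: S rule: less_induct)
  case less
  show ?case
  proof (cases "\<exists>v\<in>S. 2 * deg E v S \<le> t - 2")
    case True
    then obtain v where v: "v \<in> S" "2 * deg E v S \<le> t - 2" by blast
    have fin: "finite (S - {v})" using less by simp
    have "2 * ecount E (S - {v}) \<le> (t - 2) * card (S - {v})"
      
      using less v by (intro less.hyps) (auto simp del: card_Diff_insert intro: card_Diff1_less)
    moreover have "ecount E S = ecount E (S - {v}) + deg E v (S - {v})"
      using ecount_insert[OF assms(1) fin, of v] v by (simp add: insert_absorb)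
    moreover have "deg E v (S - {v}) \<le> deg E v S" using less by (intro deg_mono) auto
    moreover have "card S = Suc (card (S - {v}))" using v less by (metis card_Suc_Diff1)
    ultimately show ?thesis using v(2) by simp
  next
    case False
    show ?thesis
    proof (cases "S = {}")
      case True then show ?thesis using assms by simp
    next
      case S: False
      obtain p where p: "is_path E p" "set p \<subseteq> S" "p \<noteq> []"
        and longest: "\<And>q. is_path E q \<Longrightarrow> set q \<subseteq> S \<Longrightarrow> length q \<le> length p"
        using longest_path_exists[OF less.prems(1) S] by metis
      let ?q = "length p"
      have qt: "?q < t"
      proof (rule ccontr)
        assume "\<not> ?q < t"
        then have "length (take t p) = t" by simp
        moreover have "set (take t p) \<subseteq> S" using p set_take_subset by fast
        ultimately show False using less.prems(2) is_path_take[OF p(1)] by blast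
      qed
      have hdn: "x \<in> set p" if "x \<in> S" "adj E (hd p) x" for x
      proof (rule ccontr)
        assume "x \<notin> set p"
        then have "is_path E (x # p)"
          using p that adj_sym[of E] by (auto simp: is_path_def successively_Cons)
        then show False using longest[of "x # p"] p that by simp
      qed
      have lastn: "x \<in> set p" if "x \<in> S" "adj E (last p) x" for x
      proof (rule ccontr)
        assume "x \<notin> set p"
        then have "is_path E (p @ [x])"
          using p that by (auto simp: is_path_def successively_append_iff)
        then show False using longest[of "p @ [x]"] p that by simp
      qed
      have dp: "distinct p" using p by (simp add: is_path_def)
      \<comment> \<open>The shift by one in \<open>I1\<close> makes every index common to
        \<open>I1\<close> and \<open>I2\<close> a crossing in the sense of
        \<open>path_crossing\<close>.\<close>
      define I1 where "I1 = {i. i + 1 < ?q \<and> adj E (p ! 0) (p ! (i + 1))}"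
      define I2 where "I2 = {i. i + 1 < ?q \<and> adj E (last p) (p ! i)}"
      have fI: "I1 \<subseteq> {..<?q - 1}" "I2 \<subseteq> {..<?q - 1}" by (auto simp: I1_def I2_def)
      have hd0: "hd p = p ! 0" using p by (simp add: hd_conv_nth)
      have la: "last p = p ! (?q - 1)" using p by (simp add: last_conv_nth)
      have "{u \<in> S. adj E (hd p) u} \<subseteq> (\<lambda>i. p ! (i + 1)) ` I1"
      proof
        fix u assume u: "u \<in> {u \<in> S. adj E (hd p) u}"
        with hdn have "u \<in> set p" by auto
        then obtain j where j: "j < ?q" "u = p ! j" by (metis in_set_conv_nth)
        with u hd0 adj_neq[OF assms(1)] have "j \<noteq> 0" by (metis (mono_tags, lifting) mem_Collect_eq)
        then obtain i where "j = Suc i" by (cases j) auto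
        with j u hd0 show "u \<in> (\<lambda>i. p ! (i + 1)) ` I1" by (auto simp: I1_def)
      qed
      then have d1: "deg E (hd p) S \<le> card I1"
        unfolding deg_def using fI by (meson finite_lessThan finite_subset surj_card_le)
      have "{u \<in> S. adj E (last p) u} \<subseteq> (\<lambda>i. p ! i) ` I2"
      proof
        fix u assume u: "u \<in> {u \<in> S. adj E (last p) u}"
        with lastn have "u \<in> set p" by auto
        then obtain j where j: "j < ?q" "u = p ! j" by (metis in_set_conv_nth)
        have "j \<noteq> ?q - 1" using u j la adj_neq[OF assms(1), of "last p" u] by auto
        with j u show "u \<in> (\<lambda>i. p ! i) ` I2" by (auto simp: I2_def)
      qed
      then have d2: "deg E (last p) S \<le> card I2"
        unfolding deg_def using fI by (meson finite_lessThan finite_subset surj_card_le)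
      have "hd p \<in> S" "last p \<in> S" using p by auto
      with False have "2 * deg E (hd p) S > t - 2" "2 * deg E (last p) S > t - 2" by auto
      \<comment> \<open>Each end has degree above (t - 2)/2, and t - 2 is at least the number of
        available positions.\<close>
      with d1 d2 qt have big: "card I1 + card I2 > ?q - 1" by linarith
      have "I1 \<inter> I2 \<noteq> {}"
      proof
        assume "I1 \<inter> I2 = {}"
        then have "card I1 + card I2 = card (I1 \<union> I2)"
          using fI finite_subset[OF _ finite_lessThan] by (metis card_Un_disjoint)
        also have "\<dots> \<le> card {..<?q - 1}" using fI by (intro card_mono) auto
        finally show False using big by simp
      qed
      then obtain i where i: "i + 1 < ?q" "adj E (p ! 0) (p ! (i + 1))" "adj E (last p) (p ! i)"
        by (auto simp: I1_def I2_def)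
      from path_crossing[OF p(1) i] obtain c where
        c: "is_path E c" "set c = set p" "adj E (last c) (hd c)" "length c = length p" by blast
      \<comment> \<open>Such an edge would let the cycle be opened at y and prolonged by x.\<close>
      have iso: "\<not> adj E x y" if "x \<in> S - set p" "y \<in> set p" for x y
      proof
        assume xy: "adj E x y"
        from that c obtain c1 c2 where c12: "c = c1 @ y # c2" by (metis split_list)
        have "is_path E (y # c2 @ c1)" using is_path_rotate c c12 by metis
        moreover have sets: "set (y # c2 @ c1) = set p" using c c12 by auto
        ultimately have "is_path E (x # y # c2 @ c1)"
          using xy that by (auto simp: is_path_def)
        moreover have "set (x # y # c2 @ c1) \<subseteq> S" using sets that p by auto
        ultimately show False using longest[of "x # y # c2 @ c1"] c c12 by auto
      qed
      have fin: "finite (S - set p)" using less.prems by simp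
      have "ecount E S = ecount E (set p) + ecount E (S - set p) + (\<Sum>b\<in>S - set p. deg E b (set p))"
        using ecount_union[OF assms(1), of "set p" "S - set p"] fin p(2)
        by (simp add: Un_absorb1)
      moreover have "(\<Sum>b\<in>S - set p. deg E b (set p)) = 0"
        using iso by (intro sum.neutral) (auto simp: deg_def)
      \<comment> \<open>The path has fewer than t vertices, so even a clique on them is sparse
        enough.\<close>
      moreover have "2 * ecount E (set p) \<le> (t - 2) * card (set p)"
      proof -
        have "2 * ecount E (set p) \<le> card (set p) * (card (set p) - 1)"
          using ecount_le_square[OF assms(1)] by blast
        also have "\<dots> \<le> card (set p) * (t - 2)"
          using qt dp by (intro mult_le_mono2) (simp add: distinct_card)
        finally show ?thesis by (simp add: mult.commute)
      qed
      moreover have "2 * ecount E (S - set p) \<le> (t - 2) * card (S - set p)"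
      proof (rule less.hyps)
        show "card (S - set p) < card S"
          using p less.prems by (intro psubset_card_mono) (auto dest: hd_in_set)
      qed (use less.prems in auto)
      moreover have "card S = card (set p) + card (S - set p)"
        using p(2) less.prems(1) by (metis card_Un_disjoint Diff_disjoint List.finite_set Un_Diff_cancel Un_absorb1 fin)
      ultimately show ?thesis by (simp add: add_mult_distrib2)
    qed
  qed
qed

section \<open>Packing paths\<close>

text \<open>This is containment of a linear forest. The index set is arbitrary so that components
  can be split off one at a time.\<close>

definition packs :: "'a set set \<Rightarrow> 'a set \<Rightarrow> 'i set \<Rightarrow> ('i \<Rightarrow> nat) \<Rightarrow> bool" where
  "packs E S I m \<longleftrightarrow> (\<exists>P. (\<forall>i\<in>I. is_path E (P i) \<and> length (P i) = m i \<and> set (P i) \<subseteq> S) \<and>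
     (\<forall>i\<in>I. \<forall>j\<in>I. i \<noteq> j \<longrightarrow> set (P i) \<inter> set (P j) = {}))"

definition common_nbrs :: "'a set set \<Rightarrow> 'a set \<Rightarrow> 'a set \<Rightarrow> 'a set" where
  "common_nbrs E A V = {w \<in> V. \<forall>a\<in>A. adj E a w}"

lemma packs_empty [simp]: "packs E S {} m"
  by (simp add: packs_def)

lemma packs_insert:
  assumes "packs E (S - set p) I m" "is_path E p" "length p = m i" "set p \<subseteq> S" "i \<notin> I"
  shows "packs E S (insert i I) m"
proof -
  obtain P where P: "\<forall>j\<in>I. is_path E (P j) \<and> length (P j) = m j \<and> set (P j) \<subseteq> S - set p"
    "\<forall>i\<in>I. \<forall>j\<in>I. i \<noteq> j \<longrightarrow> set (P i) \<inter> set (P j) = {}"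
    using assms(1) by (auto simp: packs_def)
  show ?thesis unfolding packs_def
  proof (rule exI[of _ "P(i := p)"], intro conjI ballI impI)
    fix a b assume ab: "a \<in> insert i I" "b \<in> insert i I" "a \<noteq> b"
    have "set p \<inter> set (P j) = {}" if "j \<in> I" for j using P(1) that by blast
    then show "set ((P(i := p)) a) \<inter> set ((P(i := p)) b) = {}"
      using P(2) ab by (metis Int_commute fun_upd_apply insertE)
  next
    fix j assume "j \<in> insert i I"
    then show "is_path E ((P(i := p)) j)" "length ((P(i := p)) j) = m j" "set ((P(i := p)) j) \<subseteq> S"
      using P(1) assms by (cases "j = i"; force)+
  qed
qed

text \<open>Prefixes of paths are paths. With this, a path on 2 l vertices is cut from one on 2 l +
  1, which makes the uniform treatment of both parities possible.\<close>

lemma packs_mono: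
  assumes "packs E S I m" "S \<subseteq> T" "\<And>i. i \<in> I \<Longrightarrow> m' i \<le> m i"
  shows "packs E T I m'"
proof -
  obtain P where P: "\<forall>j\<in>I. is_path E (P j) \<and> length (P j) = m j \<and> set (P j) \<subseteq> S"
    "\<forall>i\<in>I. \<forall>j\<in>I. i \<noteq> j \<longrightarrow> set (P i) \<inter> set (P j) = {}"
    using assms(1) by (auto simp: packs_def)
  have sub: "set (take (m' i) (P i)) \<subseteq> set (P i)" for i by (rule set_take_subset)
  show ?thesis unfolding packs_def
  proof (rule exI[of _ "\<lambda>i. take (m' i) (P i)"], intro conjI ballI impI)
    fix i j assume "i \<in> I" "j \<in> I" "i \<noteq> j"
    then have "set (P i) \<inter> set (P j) = {}" using P by blast
    then show "set (take (m' i) (P i)) \<inter> set (take (m' j) (P j)) = {}"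
      using sub[of i] sub[of j] by blast
  next
    fix i assume i: "i \<in> I"
    then show "set (take (m' i) (P i)) \<subseteq> T" using P sub[of i] assms(2) by blast
    show "is_path E (take (m' i) (P i))" using P i is_path_take by blast
    show "length (take (m' i) (P i)) = m' i" using P i assms(3) by auto
  qed
qed

text \<open>Used to see that a packing blocks only boundedly many vertices of a large common
  neighbourhood.\<close>

lemma packs_support:
  assumes "packs E S I m" "finite I"
  obtains X where "X \<subseteq> S" "finite X" "card X \<le> sum m I" "packs E X I m"
proof -
  obtain P where P: "\<forall>j\<in>I. is_path E (P j) \<and> length (P j) = m j \<and> set (P j) \<subseteq> S"
    "\<forall>i\<in>I. \<forall>j\<in>I. i \<noteq> j \<longrightarrow> set (P i) \<inter> set (P j) = {}"
    using assms(1) by (auto simp: packs_def)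
  define X where "X = (\<Union>i\<in>I. set (P i))"
  have "card X \<le> (\<Sum>i\<in>I. card (set (P i)))" unfolding X_def by (rule card_UN_le[OF assms(2)])
  also have "\<dots> \<le> sum m I" using P by (intro sum_mono) (metis card_length)
  finally have "card X \<le> sum m I" .
  moreover have "packs E X I m" unfolding packs_def X_def using P by blast
  ultimately show thesis using that[of X] P assms(2) unfolding X_def by blast
qed

text \<open>Each vertex of \<open>as\<close> is followed by a fresh vertex of \<open>W\<close>,
  after which any vertex of \<open>as\<close> may come next. Hence only the first junction, from
  \<open>p\<close> into \<open>as\<close>, has to be assumed.\<close>

lemma alternating_extension:
  assumes "is_path E p" "p \<noteq> []" "distinct as" "set as \<inter> set p = {}" "finite W"
    "W \<inter> set p = {}" "W \<inter> set as = {}" "\<And>a w. a \<in> set as \<Longrightarrow> w \<in> W \<Longrightarrow> adj E a w"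
    "as \<noteq> [] \<Longrightarrow> adj E (last p) (hd as)" "length as \<le> card W"
  obtains q where "is_path E (p @ q)" "length q = 2 * length as" "set q \<subseteq> set as \<union> W"
proof -
  have "\<exists>q. is_path E (p @ q) \<and> length q = 2 * length as \<and> set q \<subseteq> set as \<union> W"
    using assms
  proof (induction as arbitrary: p W)
    case Nil
    then show ?case by (intro exI[of _ "[]"]) simp
  next
    case (Cons a as)
    then have "W \<noteq> {}" by force
    then obtain w where w: "w \<in> W" by blast
    have aw: "adj E a w" using Cons.prems w by simp
    have "a \<noteq> w" using Cons.prems w by auto
    then have p': "is_path E (p @ [a, w])"
      using Cons.prems w aw
      by (auto simp: is_path_def successively_append_iff successively_Cons)
    have "\<exists>q. is_path E ((p @ [a, w]) @ q) \<and> length q = 2 * length as \<and> set q \<subseteq> set as \<union> (W - {w})"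
    proof (rule Cons.IH)
      show "adj E (last (p @ [a, w])) (hd as)" if "as \<noteq> []"
        using Cons.prems(8)[of "hd as" w] that w adj_sym[of E] by auto
      show "length as \<le> card (W - {w})" using Cons.prems w by simp
    qed (use Cons.prems p' w in auto)
    then obtain q where "is_path E (p @ a # w # q)" "length q = 2 * length as"
      "set q \<subseteq> set as \<union> (W - {w})" by auto
    then show ?case using w by (intro exI[of _ "a # w # q"]) auto
  qed
  then show thesis using that by blast
qed

text \<open>Beginning and ending in \<open>W\<close> is what makes 2n + 1 vertices cost only n
  vertices of \<open>A\<close>. The cardinality bounds keep account of what is left for further
  paths.\<close>

lemma bipartite_path:
  assumes "finite A" "finite W" "A \<inter> W = {}" "W \<subseteq> common_nbrs E A W" "n \<le> card A" "n + 1 \<le> card W"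
  obtains p where "is_path E p" "length p = 2 * n + 1" "set p \<subseteq> A \<union> W" "card (set p \<inter> A) \<le> n"
    "card (set p \<inter> W) \<le> n + 1"
proof -
  obtain A' where A': "A' \<subseteq> A" "card A' = n" "finite A'"
    using assms(1,5) by (meson obtain_subset_with_card_n)
  obtain W' where W': "W' \<subseteq> W" "card W' = n + 1" "finite W'"
    using assms(2,6) by (meson obtain_subset_with_card_n)
  then obtain w where w: "w \<in> W'" by (metis card.empty equals0I add_is_0 one_neq_zero)
  obtain as where as: "set as = A'" "distinct as" using A' finite_distinct_list by blast
  have adj: "adj E a x" if "a \<in> A'" "x \<in> W'" for a x
    using that A' W' assms(4) by (auto simp: common_nbrs_def)
  have "length as = n" using as A' distinct_card by fastforce
  moreover have "adj E w (hd as)" if "as \<noteq> []"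
    using adj[of "hd as" w] w that as(1) adj_sym[of E] by auto
  moreover have "is_path E [w]" by (simp add: is_path_def)
  moreover have "set as \<inter> set [w] = {}" "(W' - {w}) \<inter> set as = {}"
    using as A' W' w assms(3) by auto
  moreover have "length as \<le> card (W' - {w})" using calculation(1) W' w by simp
  ultimately obtain q where q: "is_path E ([w] @ q)" "length q = 2 * n" "set q \<subseteq> A' \<union> (W' - {w})"
    using alternating_extension[of E "[w]" as "W' - {w}"] as W' adj by (auto simp del: append.simps)
  have qs: "set (w # q) \<subseteq> A' \<union> W'" using q w by auto
  have "set (w # q) \<inter> A \<subseteq> A'" "set (w # q) \<inter> W \<subseteq> W'" using qs A' W' assms(3) by blast+
  then have "card (set (w # q) \<inter> A) \<le> n" "card (set (w # q) \<inter> W) \<le> n + 1"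
    using A' W' card_mono by metis+
  moreover have "set (w # q) \<subseteq> A \<union> W" using qs A' W' by blast
  ultimately show thesis using that[of "w # q"] q by simp
qed

lemma packs_bipartite:
  assumes "finite I" "finite A" "finite W" "A \<inter> W = {}" "W \<subseteq> common_nbrs E A W"
    "sum l I \<le> card A" "(\<Sum>i\<in>I. l i + 1) \<le> card W"
  shows "packs E (A \<union> W) I (\<lambda>i. 2 * l i + 1)"
  using assms
proof (induction I arbitrary: A W)
  case (insert i I)
  then obtain p where p: "is_path E p" "length p = 2 * l i + 1" "set p \<subseteq> A \<union> W"
    "card (set p \<inter> A) \<le> l i" "card (set p \<inter> W) \<le> l i + 1"
    using bipartite_path[of A W E "l i" thesis] insert.hyps by simp
  have "packs E ((A - set p) \<union> (W - set p)) I (\<lambda>i. 2 * l i + 1)"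
  proof (rule insert.IH)
    have "card (A - set p) = card A - card (set p \<inter> A)"
      using insert.prems by (simp add: card_Diff_subset_Int Int_commute)
    then show "sum l I \<le> card (A - set p)" using insert.prems insert.hyps p by simp
    have "card (W - set p) = card W - card (set p \<inter> W)"
      using insert.prems by (simp add: card_Diff_subset_Int Int_commute)
    then show "(\<Sum>i\<in>I. l i + 1) \<le> card (W - set p)" using insert.prems insert.hyps p by simp
  qed (use insert.prems in \<open>auto simp: common_nbrs_def\<close>)
  moreover have "(A - set p) \<union> (W - set p) = (A \<union> W) - set p" by blast
  ultimately show ?case
    using packs_insert[of E "A \<union> W" p I "\<lambda>i. 2 * l i + 1" i] p insert.hyps by simp
qed simp

section \<open>Common neighbours by pigeonhole, and a first edge bound for forests\<close>

lemma common_neighbours_pigeonhole: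
  assumes "finite Q" "finite V" "2 ^ card Q * M < card {v \<in> V. a \<le> deg E v Q}"
  obtains A where "A \<subseteq> Q" "card A = a" "M < card (common_nbrs E A V)"
proof (rule ccontr)
  assume "\<not> thesis"
  then have small: "card (common_nbrs E A V) \<le> M" if "A \<subseteq> Q" "card A = a" for A
    using that \<open>\<And>A. A \<subseteq> Q \<Longrightarrow> card A = a \<Longrightarrow> M < card (common_nbrs E A V) \<Longrightarrow> thesis\<close> not_le by blast
  let ?F = "{A \<in> Pow Q. card A = a}"
  have "{v \<in> V. a \<le> deg E v Q} \<subseteq> (\<Union>A\<in>?F. common_nbrs E A V)"
  proof
    fix v assume v: "v \<in> {v \<in> V. a \<le> deg E v Q}"
    \<comment> \<open>Each such vertex is a common neighbour of some a-subset of \<open>Q\<close>,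
      and there are at most 2^|Q| subsets.\<close>
    then obtain A where "A \<subseteq> {u \<in> Q. adj E v u}" "card A = a"
      unfolding deg_def by (metis (no_types, lifting) mem_Collect_eq obtain_subset_with_card_n)
    then have "A \<in> ?F" "v \<in> common_nbrs E A V" using v adj_sym[of E] by (auto simp: common_nbrs_def)
    then show "v \<in> (\<Union>A\<in>?F. common_nbrs E A V)" by blast
  qed
  then have "card {v \<in> V. a \<le> deg E v Q} \<le> card (\<Union>A\<in>?F. common_nbrs E A V)"
    using assms by (intro card_mono) (auto simp: common_nbrs_def)
  also have "\<dots> \<le> (\<Sum>A\<in>?F. card (common_nbrs E A V))" using assms by (intro card_UN_le) auto
  also have "\<dots> \<le> (\<Sum>A\<in>?F. M)" using small by (intro sum_mono) auto
  also have "\<dots> = card ?F * M" by simp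
  also have "\<dots> \<le> card (Pow Q) * M" using assms by (intro mult_le_mono1 card_mono) auto
  also have "\<dots> = 2 ^ card Q * M" using assms by (simp add: card_Pow)
  finally show False using assms(3) by simp
qed

lemma ecount_remove:
  assumes "edge_set E" "finite S" "finite A"
  shows "ecount E S \<le> ecount E (S - A) + card A * card S"
  using assms(3)
proof (induction A)
  case (insert a A)
  let ?T = "S - insert a A"
  have "ecount E (S - A) \<le> ecount E ?T + card S"
  proof (cases "a \<in> S")
    case True
    then have eq: "S - A = insert a ?T" using insert.hyps by auto
    have "ecount E (S - A) = ecount E ?T + deg E a ?T"
      unfolding eq by (rule ecount_insert[OF assms(1)]) (use assms(2) in auto)
    moreover have "deg E a ?T \<le> card S" using deg_mono[of S ?T E a] deg_le[of S E a] assms(2) by auto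
    ultimately show ?thesis by simp
  next
    case False
    then have "?T = S - A" by auto
    then show ?thesis by simp
  qed
  moreover have "card (insert a A) * card S = card S + card A * card S"
    using insert.hyps by simp
  ultimately show ?case using insert.IH by linarith
qed simp

text \<open>If every a-subset of \<open>Q\<close> has at most M common neighbours, all but 2^|Q| M
  vertices outside \<open>Q\<close> send at most a - 1 edges into \<open>Q\<close>. The exceptions
  and the edges inside \<open>Q\<close> form the last summand. In the applications \<open>Q\<close>
  is the vertex set of one path, so |Q| is bounded.\<close>

lemma common_neighbours_or_few_edges:
  assumes "edge_set E" "finite S" "Q \<subseteq> S"
  shows "(\<exists>A\<subseteq>Q. card A = a \<and> M < card (common_nbrs E A (S - Q))) \<or>
    ecount E S \<le> ecount E (S - Q) + (a - 1) * card S + card Q * (card Q + 2 ^ card Q * M)"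
proof (rule disjCI)
  assume no: "\<not> ecount E S \<le> ecount E (S - Q) + (a - 1) * card S + card Q * (card Q + 2 ^ card Q * M)"
  have fin: "finite Q" "finite (S - Q)" using assms finite_subset by auto
  let ?B = "{v \<in> S - Q. a \<le> deg E v Q}"
  have "ecount E S = ecount E Q + ecount E (S - Q) + (\<Sum>b\<in>S - Q. deg E b Q)"
    using ecount_union[OF assms(1) fin] assms(3) by (simp add: Un_absorb1)
  moreover have "2 * ecount E Q \<le> card Q * card Q"
    using ecount_le_square[OF assms(1) fin(1)] mult_le_mono2[of "card Q - 1" "card Q" "card Q"] by linarith
  moreover have "(\<Sum>b\<in>S - Q. deg E b Q) \<le> (\<Sum>b\<in>S - Q. (a - 1) + (if a \<le> deg E b Q then card Q else 0))"
    using deg_le[OF fin(1), of E] by (intro sum_mono) (auto intro: trans_le_add2)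
  moreover have "\<dots> = (a - 1) * card (S - Q) + card Q * card ?B"
    using fin(2) by (simp add: sum.distrib sum.If_cases Int_def mult.commute)
  moreover have "\<dots> \<le> (a - 1) * card S + card Q * card ?B"
    using assms by (intro add_right_mono mult_le_mono2 card_mono) auto
  ultimately have "card Q * (card Q + 2 ^ card Q * M) < card Q * card Q + card Q * card ?B"
    using no by linarith
  then have "2 ^ card Q * M < card ?B" by (simp add: algebra_simps)
  then show "\<exists>A\<subseteq>Q. card A = a \<and> M < card (common_nbrs E A (S - Q))"
    using common_neighbours_pigeonhole[OF fin, of M a E] by metis
qed

text \<open>Induction on the components. If l_i vertices of a copy of path i have many common
  neighbours, deleting them costs at most l_i n edges and destroys all copies of the remaining
  forest, because path i could be rebuilt through them. Otherwise deleting the whole copy costs only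
  (l_i - 1) n + O(1) edges. The missing half comes from the base case.\<close>

lemma forest_edge_bound:
  assumes "finite I" "I \<noteq> {}" "\<And>i. i \<in> I \<Longrightarrow> l i \<ge> 1"
  shows "\<exists>c. \<forall>(E :: 'a set set) S. edge_set E \<longrightarrow> finite S \<longrightarrow> \<not> packs E S I (\<lambda>i. 2 * l i + 1) \<longrightarrow>
    2 * ecount E S \<le> (2 * sum l I - 1) * card S + c"
  using assms
proof (induction I rule: finite_ne_induct)
  case (singleton i)
  have "2 * ecount E S \<le> (2 * l i - 1) * card S"
    if "edge_set E" "finite S" "\<not> packs E S {i} (\<lambda>i. 2 * l i + 1)" for E :: "'a set set" and S
  proof -
    have "2 * ecount E S \<le> (2 * l i + 1 - 2) * card S"
    proof (rule erdos_gallai[OF that(1,2)])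
      fix p assume "is_path E p" "set p \<subseteq> S"
      then show "length p \<noteq> 2 * l i + 1"
        using packs_insert[of E S p "{}" "\<lambda>i. 2 * l i + 1" i] that by auto
    qed (use singleton in auto)
    then show ?thesis by simp
  qed
  then show ?case by (intro exI[of _ 0]) simp
next
  case (insert i I)
  let ?m = "\<lambda>i. 2 * l i + 1"
  have li: "l i \<ge> 1" using insert.prems by simp
  have sI: "sum l I \<ge> 1" using insert by (metis ex_in_conv member_le_sum insertI2 le_trans le0)
  have sins: "sum l (insert i I) = l i + sum l I" using insert by simp
  obtain c where c: "\<And>(E :: 'a set set) S. edge_set E \<Longrightarrow> finite S \<Longrightarrow> \<not> packs E S I ?m \<Longrightarrow>
      2 * ecount E S \<le> (2 * sum l I - 1) * card S + c"
    using insert.IH insert.prems by blast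
  \<comment> \<open>The other paths block at most \<open>sum ?m I\<close> common neighbours, and
    rebuilding path i takes \<open>l i + 1\<close> further ones.\<close>
  define M where "M = sum ?m I + l i + 1"
  define D where "D = ?m i * (?m i + 2 ^ ?m i * M)"
  define C where "C = 2 * D + c"
  show ?case
  proof (intro exI[of _ C] allI impI)
    fix E :: "'a set set" and S
    assume E: "edge_set E" "finite S" "\<not> packs E S (insert i I) ?m"
    show "2 * ecount E S \<le> (2 * sum l (insert i I) - 1) * card S + C"
    proof (cases "\<exists>p. is_path E p \<and> length p = ?m i \<and> set p \<subseteq> S")
      case False
      then have "2 * ecount E S \<le> (?m i - 2) * card S"
        using li by (intro erdos_gallai[OF E(1,2)]) auto
      also have "\<dots> \<le> (2 * sum l (insert i I) - 1) * card S"
        using sins by (intro mult_le_mono1) simp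
      finally show ?thesis by simp
    next
      case True
      then obtain p where p: "is_path E p" "length p = ?m i" "set p \<subseteq> S" by blast
      have cp: "card (set p) = ?m i" using p by (metis distinct_card is_path_def)
      consider (A) A where "A \<subseteq> set p" "card A = l i" "M < card (common_nbrs E A (S - set p))"
        | (few) "ecount E S \<le> ecount E (S - set p) + (l i - 1) * card S + D"
        using common_neighbours_or_few_edges[OF E(1,2) p(3), of "l i" M] cp unfolding D_def by metis
      then show ?thesis
      proof cases
        case A
        define W where "W = common_nbrs E A (S - set p)"
        have fA: "finite A" using A(1) finite_subset by blast
        have fW: "finite W" using E(2) by (auto simp: W_def common_nbrs_def)
        have "\<not> packs E (S - A) I ?m"
        proof
          assume "packs E (S - A) I ?m"
          then obtain X where X: "X \<subseteq> S - A" "finite X" "card X \<le> sum ?m I" "packs E X I ?m"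
            using packs_support insert.hyps(1) by metis
          have "card (W - X) \<ge> l i + 1"
            using A(3) X(3) diff_card_le_card_Diff[OF X(2), of W] unfolding W_def M_def by linarith
          moreover have "A \<inter> (W - X) = {}" using A(1) by (auto simp: W_def common_nbrs_def)
          moreover have "W - X \<subseteq> common_nbrs E A (W - X)" by (auto simp: W_def common_nbrs_def)
          ultimately obtain p' where p': "is_path E p'" "length p' = ?m i" "set p' \<subseteq> A \<union> (W - X)"
            using bipartite_path[of A "W - X" E "l i" thesis] fA fW A(2) by simp
          have "packs E (S - set p') I ?m"
            by (rule packs_mono[OF X(4)]) (use X(1) p'(3) in auto)
          moreover have "set p' \<subseteq> S" using p'(3) A(1) p(3) by (auto simp: W_def common_nbrs_def)
          ultimately show False using E(3) packs_insert[of E S p' I ?m i] p' insert.hyps by blast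
        qed
        then have "2 * ecount E (S - A) \<le> (2 * sum l I - 1) * card (S - A) + c"
          using c[of E "S - A"] E by simp
        also have "\<dots> \<le> (2 * sum l I - 1) * card S + c"
          using E by (intro add_right_mono mult_le_mono2 card_mono) auto
        finally have "2 * ecount E S \<le> (2 * l i + (2 * sum l I - 1)) * card S + c"
          using ecount_remove[OF E(1,2) fA] A(2) by (simp add: add_mult_distrib)
        moreover have "2 * l i + (2 * sum l I - 1) = 2 * sum l (insert i I) - 1"
          using sins sI by simp
        ultimately show ?thesis unfolding C_def by simp
      next
        case few
        have "\<not> packs E (S - set p) I ?m"
          using E(3) packs_insert[of E S p I ?m i] p insert.hyps by blast
        then have "2 * ecount E (S - set p) \<le> (2 * sum l I - 1) * card (S - set p) + c"
          using c[of E "S - set p"] E by simp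
        also have "\<dots> \<le> (2 * sum l I - 1) * card S + c"
          using E by (intro add_right_mono mult_le_mono2 card_mono) auto
        finally have "2 * ecount E S \<le> (2 * (l i - 1) + (2 * sum l I - 1)) * card S + C"
          using few unfolding C_def add_mult_distrib by linarith
        also have "\<dots> \<le> (2 * sum l (insert i I) - 1) * card S + C"
          using sins by (intro add_right_mono mult_le_mono1) simp
        finally show ?thesis .
      qed
    qed
  qed
qed

section \<open>Stability\<close>

text \<open>The component of smallest half-length \<open>a\<close> is chosen. Deleting one of its copies \<open>P\<close> leaves a graph
  that is free of the remaining forest and hence loses at least \<open>(a - 1/2) n\<close> edges; so \<open>a\<close> vertices
  of \<open>P\<close> have linearly many common_nbrs neighbours. Thus every copy meets the bounded set \<open>L\<close> of vertices
  of linear degree at least \<open>a\<close> times. Vertices outside \<open>L\<close> are sorted by their neighbourhood in \<open>L\<close>.\<close>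

lemma stability:
  assumes I: "finite I" "card I \<ge> 2" and l: "\<And>i. i \<in> I \<Longrightarrow> l i \<ge> 1"
  shows "\<exists>N. \<forall>(E :: 'a set set) S. edge_set E \<longrightarrow> finite S \<longrightarrow> N \<le> card S \<longrightarrow>
    \<not> packs E S I (\<lambda>i. 2 * l i + 1) \<longrightarrow> 2 * (sum l I - 1) * card S \<le> 2 * ecount E S + c \<longrightarrow>
    (\<exists>A\<subseteq>S. card A = sum l I - 1 \<and> M \<le> card (common_nbrs E A (S - A)))"
proof -
  let ?m = "\<lambda>i. 2 * l i + 1"
  define s where "s = sum l I"
  have Ine: "I \<noteq> {}" using I by auto
  \<comment> \<open>Minimality gives a <= s - a, which pays for the vertices with few neighbours in
    \<open>L\<close> in the final sum.\<close>
  obtain i where i: "i \<in> I" "\<And>j. j \<in> I \<Longrightarrow> l i \<le> l j"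
    using ex_is_arg_min_if_finite[OF I(1) Ine, of l] by (auto simp: is_arg_min_linorder)
  define I' where "I' = I - {i}"
  define a where "a = l i"
  define s' where "s' = sum l I'"
  have I': "finite I'" "I' \<noteq> {}" "i \<notin> I'" "I = insert i I'"
  proof -
    show "finite I'" "i \<notin> I'" "I = insert i I'" using I(1) i(1) by (auto simp: I'_def)
    then show "I' \<noteq> {}" using I(2) by auto
  qed
  have s: "s = a + s'" using I' by (simp add: s_def a_def s'_def)
  have a1: "a \<ge> 1" using l i a_def by blast
  obtain j where j: "j \<in> I'" using I' by blast
  have "l j \<le> s'" unfolding s'_def using j I' by (intro member_le_sum) auto
  then have as': "a \<le> s'" using i(2)[of j] j I' a_def by auto
  define q where "q = 2 * a + 1"
  obtain c1 where c1: "\<And>(E :: 'a set set) S. edge_set E \<Longrightarrow> finite S \<Longrightarrow> \<not> packs E S I' ?m \<Longrightarrow>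
      2 * ecount E S \<le> (2 * s' - 1) * card S + c1"
    using forest_edge_bound[OF I'(1,2), of l] l I' unfolding s'_def by blast
  obtain c2 where c2: "\<And>(E :: 'a set set) S. edge_set E \<Longrightarrow> finite S \<Longrightarrow> \<not> packs E S I ?m \<Longrightarrow>
      2 * ecount E S \<le> (2 * s - 1) * card S + c2"
    using forest_edge_bound[OF I(1) Ine, of l] l unfolding s_def by blast
  \<comment> \<open>\<open>G\<close> is the coefficient of M in the error term of
    \<open>common_neighbours_or_few_edges\<close> for |Q| = q. \<open>K\<close> bounds |L|: the
    degrees sum to at most (2 s + c2) n, and vertices of \<open>L\<close> have degree at least n /
    (4 G). \<open>M0\<close> leaves room in a class for M common neighbours, and for a - 1 path
    vertices besides three used ones. \<open>N\<close> exceeds the constants in both contradictions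
    below.\<close>
  define G where "G = q * 2 ^ q"
  have Gpos: "G > 0" by (simp add: G_def q_def)
  define K where "K = 4 * G * (2 * s + c2)"
  define M0 where "M0 = M + a + 3"
  define N where "N = 2 * (c + c1 + 2 * (q * q)) + c + K * K + (2 * K + 2 * a) * (2 ^ K * M0) + 1"
  have main: "\<exists>A\<subseteq>S. card A = s - 1 \<and> M \<le> card (common_nbrs E A (S - A))"
    if E: "edge_set E" and S: "finite S" and nN: "N \<le> card S" and free: "\<not> packs E S I ?m"
      and dense: "2 * (s - 1) * card S \<le> 2 * ecount E S + c" for E :: "'a set set" and S
  proof (rule ccontr)
    assume "\<not> ?thesis"
    then have noA: "card (common_nbrs E A (S - A)) < M" if "A \<subseteq> S" "card A = s - 1" for A
      using that not_le by blast
    let ?n = "card S"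
    \<comment> \<open>A linear threshold, chosen so that the doubled error 2 G M' is at most n/2 and
      stays below the surplus n.\<close>
    define M' where "M' = ?n div (4 * G)"
    have GM': "4 * G * M' \<le> ?n" "?n \<le> 4 * G * (M' + 1)"
    proof -
      show "4 * G * M' \<le> ?n" unfolding M'_def by (rule times_div_less_eq_dividend)
      have "?n < 4 * G * (M' + 1)"
        unfolding M'_def using dividend_less_times_div[of "4 * G" ?n] Gpos by simp
      then show "?n \<le> 4 * G * (M' + 1)" by simp
    qed
    define L where "L = {v \<in> S. M' < deg E v S}"
    have L: "L \<subseteq> S" "finite L" using S by (auto simp: L_def)
    have path_L: "a \<le> card (set p \<inter> L)" if p: "is_path E p" "set p \<subseteq> S" "length p = q" for p
    proof -
      have cp: "card (set p) = q" using p by (metis distinct_card is_path_def)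
      consider (A) A where "A \<subseteq> set p" "card A = a" "M' < card (common_nbrs E A (S - set p))"
        | (few) "ecount E S \<le> ecount E (S - set p) + (a - 1) * ?n + q * (q + 2 ^ q * M')"
        using common_neighbours_or_few_edges[OF E S p(2), of a M'] cp by metis
      then show ?thesis
      proof cases
        case A
        have "A \<subseteq> L"
        proof
          fix v assume v: "v \<in> A"
          have "common_nbrs E A (S - set p) \<subseteq> {u \<in> S. adj E v u}" using v by (auto simp: common_nbrs_def)
          then have "card (common_nbrs E A (S - set p)) \<le> deg E v S"
            unfolding deg_def using S by (intro card_mono) auto
          then show "v \<in> L" using A v p by (auto simp: L_def)
        qed
        then have "A \<subseteq> set p \<inter> L" using A by blast
        then show ?thesis using A(2) card_mono[of "set p \<inter> L" A] by simp
      next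
        case few
        have "\<not> packs E (S - set p) I' ?m"
          using free packs_insert[of E S p I' ?m i] p I' by (auto simp: q_def a_def)
        then have "2 * ecount E (S - set p) \<le> (2 * s' - 1) * card (S - set p) + c1"
          using c1[of E "S - set p"] E S by simp
        also have "\<dots> \<le> (2 * s' - 1) * ?n + c1"
          using S by (intro add_right_mono mult_le_mono2 card_mono) auto
        finally have "2 * (s - 1) * ?n \<le> (2 * s' - 1) * ?n + c1 + 2 * (a - 1) * ?n + 2 * (q * q) + 2 * (G * M') + c"
          using few dense unfolding G_def by (simp add: algebra_simps)
        \<comment> \<open>The last summand is the surplus: losing only a - 1 edges per vertex would
          leave the graph n short in the doubled count.\<close>
        moreover have "2 * (s - 1) * ?n = (2 * s' - 1) * ?n + 2 * (a - 1) * ?n + ?n"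
        proof -
          have "2 * (s - 1) = (2 * s' - 1) + 2 * (a - 1) + 1" using s a1 as' by simp
          then show ?thesis by (simp only: add_mult_distrib mult_1)
        qed
        ultimately have "2 * ?n \<le> 2 * (c + c1 + 2 * (q * q)) + 4 * G * M'" by simp
        then have "?n \<le> 2 * (c + c1 + 2 * (q * q))" using GM'(1) by linarith
        then show ?thesis using nN unfolding N_def by linarith
      qed
    qed
    have cL: "card L \<le> K"
    proof -
      have n1: "?n > 0" using nN unfolding N_def by linarith
      have "card L * (M' + 1) = (\<Sum>v\<in>L. M' + 1)" by simp
      also have "\<dots> \<le> (\<Sum>v\<in>L. deg E v S)" by (rule sum_mono) (auto simp: L_def)
      also have "\<dots> \<le> (\<Sum>v\<in>S. deg E v S)" using L S by (intro sum_mono2) auto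
      also have "\<dots> \<le> (2 * s - 1) * ?n + c2" using handshake[OF E S] c2[OF E S free] by simp
      also have "\<dots> \<le> (2 * s) * ?n + c2 * ?n" using n1 by (intro add_mono mult_le_mono1) auto
      finally have "card L * (M' + 1) \<le> (2 * s + c2) * ?n" by (simp add: add_mult_distrib)
      then have "4 * G * (card L * (M' + 1)) \<le> K * ?n" unfolding K_def mult.assoc by (intro mult_le_mono2)
      moreover have "card L * ?n \<le> card L * (4 * G * (M' + 1))" using GM'(2) by (intro mult_le_mono2)
      moreover have "card L * (4 * G * (M' + 1)) = 4 * G * (card L * (M' + 1))"
        by (rule mult.left_commute)
      ultimately have "card L * ?n \<le> K * ?n" by linarith
      then show ?thesis using n1 by simp
    qed
    define T where "T v = {u \<in> L. adj E v u}" for v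
    have dT: "deg E v L = card (T v)" for v by (simp add: deg_def T_def)
    have TL: "T v \<subseteq> L" "finite (T v)" for v using L by (auto simp: T_def)
    \<comment> \<open>Vertices outside \<open>L\<close> with the same neighbours in \<open>L\<close>
      are interchangeable on alternating paths. There are at most 2^K classes, so the small ones
      together hold boundedly many vertices.\<close>
    define cls where "cls v = {w \<in> S - L. T w = T v}" for v
    have fcls: "finite (cls v)" for v using S by (simp add: cls_def)
    have cls_adj: "adj E x w" if "x \<in> T v" "w \<in> cls v" for x w v
      using that adj_sym[of E] by (auto simp: cls_def T_def)
    define Y where "Y = {v \<in> S - L. a \<le> card (T v) + 1 \<and> M0 \<le> card (cls v)}"
    define Z where "Z = {v \<in> S - L. card (cls v) < M0}"
    have cZ: "card Z \<le> 2 ^ K * M0"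
    proof -
      have "Z \<subseteq> (\<Union>t\<in>T ` Z. {w \<in> S - L. T w = t})" by (auto simp: Z_def)
      then have "card Z \<le> card (\<Union>t\<in>T ` Z. {w \<in> S - L. T w = t})"
        using S by (intro card_mono) (auto simp: Z_def)
      also have "\<dots> \<le> (\<Sum>t\<in>T ` Z. card {w \<in> S - L. T w = t})"
        using S by (intro card_UN_le) (auto simp: Z_def)
      also have "\<dots> \<le> (\<Sum>t\<in>T ` Z. M0)" by (rule sum_mono) (auto simp: Z_def cls_def)
      also have "\<dots> = card (T ` Z) * M0" by simp
      also have "\<dots> \<le> card (Pow L) * M0"
        using L TL by (intro mult_le_mono1 card_mono) auto
      also have "\<dots> = 2 ^ card L * M0" using L by (simp add: card_Pow)
      also have "\<dots> \<le> 2 ^ K * M0" using cL by (intro mult_le_mono1 power_increasing) auto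
      finally show ?thesis .
    qed
    \<comment> \<open>Continue z, v, u by alternating between a - 1 neighbours of u in
      \<open>L\<close> and the class of u. This path on 2a + 1 vertices meets \<open>L\<close> only
      a - 1 times, against \<open>path_L\<close>.\<close>
    have noP3: "False" if u: "u \<in> Y" "v \<in> S - L" "z \<in> S - L" "z \<noteq> u" "adj E z v" "adj E v u" for u v z
    proof -
      have "a \<le> card (T u) + 1" using u by (simp add: Y_def)
      then have "a - 1 \<le> card (T u)" by linarith
      then obtain B where B: "B \<subseteq> T u" "card B = a - 1" "finite B"
        by (meson obtain_subset_with_card_n)
      obtain as where as: "set as = B" "distinct as" using B finite_distinct_list by blast
      have las: "length as = a - 1" using as B distinct_card by fastforce
      have uSL: "u \<in> S - L" using u by (simp add: Y_def)
      have ne: "v \<noteq> u" "z \<noteq> v" using u adj_neq[OF E] by auto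
      have "M0 \<le> card (cls u)" using u by (simp add: Y_def)
      moreover have "card (set [z, v, u]) \<le> 3" using card_length[of "[z, v, u]"] by simp
      moreover have "card (cls u) - card (set [z, v, u]) \<le> card (cls u - set [z, v, u])"
        by (intro diff_card_le_card_Diff) simp
      ultimately have "a - 1 \<le> card (cls u - set [z, v, u])"
        unfolding M0_def by linarith
      moreover have "is_path E [z, v, u]" using u ne by (simp add: is_path_def)
      moreover have "set as \<inter> set [z, v, u] = {}" using as B TL[of u] u uSL by auto
      moreover have "(cls u - set [z, v, u]) \<inter> set as = {}" using as B TL[of u] by (auto simp: cls_def)
      moreover have "adj E u (hd as)" if "as \<noteq> []"
        using that as B hd_in_set[of as] by (auto simp: T_def)
      moreover have "adj E x w" if "x \<in> set as" "w \<in> cls u - set [z, v, u]" for x w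
        using that as B cls_adj[of x u w] by auto
      ultimately obtain p where p: "is_path E ([z, v, u] @ p)" "length p = 2 * (a - 1)"
        "set p \<subseteq> B \<union> cls u"
        using alternating_extension[of E "[z, v, u]" as "cls u - set [z, v, u]" thesis] as las fcls
        by (simp del: append.simps list.set) blast
      have "a \<le> card (set ([z, v, u] @ p) \<inter> L)"
      proof (rule path_L[OF p(1)])
        have "cls u \<subseteq> S" "B \<subseteq> S" using B TL[of u] L by (auto simp: cls_def)
        then show "set ([z, v, u] @ p) \<subseteq> S" using p u uSL by auto
        show "length ([z, v, u] @ p) = q" using p a1 by (simp add: q_def)
      qed
      moreover have "set ([z, v, u] @ p) \<inter> L \<subseteq> B" using p u uSL by (auto simp: cls_def)
      ultimately have "a \<le> card B" using B card_mono[of B] order.trans by blast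
      then show False using B a1 by simp
    qed
    \<comment> \<open>In the doubled count a vertex of \<open>Y\<close> pays 1 and any other vertex
      pays 2a. By \<open>noP3\<close>, a vertex outside \<open>Y\<close> adjacent to some u in
      \<open>Y\<close> has no other neighbour, so deleting it loses one edge; an edge inside
      \<open>Y\<close> is isolated and is paid for by its two ends. Once \<open>Y\<close> is
      isolated, the rest has no path on q vertices, since it avoids \<open>L\<close>.\<close>
    have low: "2 * ecount E R \<le> card (R \<inter> Y) + 2 * a * card (R - Y)" if "R \<subseteq> S - L" for R
      using that
    proof (induction "card R" arbitrary: R rule: less_induct)
      case less
      have fR: "finite R" using less.prems S finite_subset by blast
      have P3: "False" if "u \<in> Y" "u \<in> R" "v \<in> R" "z \<in> R" "z \<noteq> u" "adj E z v" "adj E v u" for u v z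
        using noP3[of u v z] that less.prems by blast
      consider (YZ) v u where "v \<in> R - Y" "u \<in> R \<inter> Y" "adj E v u"
        | (YY) u u' where "u \<in> R \<inter> Y" "u' \<in> R \<inter> Y" "adj E u u'"
        | (none) "\<And>v u. v \<in> R \<Longrightarrow> u \<in> R \<inter> Y \<Longrightarrow> \<not> adj E v u"
        by blast
      then show ?case
      proof cases
        case YZ
        have "{x \<in> R - {v}. adj E v x} \<subseteq> {u}" using YZ P3[of u v] adj_sym[of E] by blast
        then have "deg E v (R - {v}) \<le> card {u}" unfolding deg_def by (intro card_mono) auto
        moreover have "ecount E R = ecount E (R - {v}) + deg E v (R - {v})"
          using ecount_insert[OF E, of "R - {v}" v] fR YZ by (simp add: insert_absorb)
        moreover have "2 * ecount E (R - {v}) \<le> card ((R - {v}) \<inter> Y) + 2 * a * card (R - {v} - Y)"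
          using YZ less.prems fR by (intro less.hyps psubset_card_mono) auto
        moreover have "(R - {v}) \<inter> Y = R \<inter> Y" using YZ by blast
        moreover have "card (R - Y) = Suc (card (R - {v} - Y))"
        proof -
          have "R - Y = insert v (R - {v} - Y)" using YZ by blast
          then show ?thesis using fR by (metis DiffD1 DiffD2 card_insert_disjoint finite_Diff insertI1)
        qed
        ultimately show ?thesis using a1 by (simp add: algebra_simps)
      next
        case YY
        let ?R = "R - {u} - {u'}"
        have ne: "u \<noteq> u'" using YY adj_neq[OF E] by blast
        have "{x \<in> R - {u}. adj E u x} \<subseteq> {u'}" using YY P3[of u' u] adj_sym[of E] by blast
        then have "deg E u (R - {u}) \<le> card {u'}" unfolding deg_def by (intro card_mono) auto
        moreover have "{x \<in> ?R. adj E u' x} = {}" using YY P3[of u u'] adj_sym[of E] by blast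
        then have "deg E u' ?R = 0" unfolding deg_def by (metis card.empty)
        moreover have "ecount E R = ecount E (R - {u}) + deg E u (R - {u})"
          using ecount_insert[OF E, of "R - {u}" u] fR YY by (simp add: insert_absorb)
        moreover have "ecount E (R - {u}) = ecount E ?R + deg E u' ?R"
          using ecount_insert[OF E, of ?R u'] fR YY ne by (simp add: insert_absorb)
        moreover have "2 * ecount E ?R \<le> card (?R \<inter> Y) + 2 * a * card (?R - Y)"
          using YY less.prems fR by (intro less.hyps psubset_card_mono) auto
        moreover have "?R - Y = R - Y" using YY by blast
        moreover have "card (R \<inter> Y) = Suc (Suc (card (?R \<inter> Y)))"
        proof -
          have "R \<inter> Y = insert u (insert u' (?R \<inter> Y))" using YY by blast
          then show ?thesis using fR ne by simp
        qed
        ultimately show ?thesis by simp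
      next
        case none
        have fin: "finite (R \<inter> Y)" "finite (R - Y)" using fR by auto
        have d0: "deg E b (R \<inter> Y) = 0" if "b \<in> R" for b
        proof -
          have "{x \<in> R \<inter> Y. adj E b x} = {}" using none[OF that] by blast
          then show ?thesis unfolding deg_def by (metis card.empty)
        qed
        have "ecount E R = ecount E (R \<inter> Y) + ecount E (R - Y) + (\<Sum>b\<in>R - Y. deg E b (R \<inter> Y))"
          using ecount_union[OF E fin] by (simp add: Int_Diff_Un Diff_Int_distrib2 disjoint_iff)
        moreover have "(\<Sum>b\<in>R - Y. deg E b (R \<inter> Y)) = 0"
          using d0 by (intro sum.neutral) auto
        moreover have "(\<Sum>b\<in>R \<inter> Y. deg E b (R \<inter> Y)) = 0"
          using d0 by (intro sum.neutral) auto
        then have "ecount E (R \<inter> Y) = 0" using handshake[OF E fin(1)] by simp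
        moreover have "2 * ecount E (R - Y) \<le> (q - 2) * card (R - Y)"
        proof (rule erdos_gallai[OF E fin(2)])
          fix p assume p: "is_path E p" "set p \<subseteq> R - Y"
          then have "set p \<inter> L = {}" "set p \<subseteq> S" using less.prems by auto
          then show "length p \<noteq> q" using path_L[OF p(1)] a1 by auto
        qed (use a1 in \<open>simp add: q_def\<close>)
        moreover have "(q - 2) * card (R - Y) \<le> 2 * a * card (R - Y)"
          by (rule mult_le_mono1) (simp add: q_def)
        ultimately show ?thesis by linarith
      qed
    qed
    \<comment> \<open>Otherwise s - 1 vertices of \<open>T v\<close> would have the large class of v
      among their common neighbours.\<close>
    have Ydeg: "card (T v) + 1 < s" if "v \<in> Y" for v
    proof (rule ccontr)
      assume "\<not> card (T v) + 1 < s"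
      then obtain A where A: "A \<subseteq> T v" "card A = s - 1"
        by (metis (no_types) add.commute le_diff_conv not_less obtain_subset_with_card_n add_diff_cancel_right' diff_le_mono)
      have "cls v \<subseteq> common_nbrs E A (S - A)"
        using A TL[of v] cls_adj by (auto simp: common_nbrs_def cls_def)
      then have "card (cls v) \<le> card (common_nbrs E A (S - A))"
        using S by (intro card_mono) (auto simp: common_nbrs_def)
      moreover have "M \<le> card (cls v)" using that by (simp add: Y_def M0_def)
      moreover have "A \<subseteq> S" using A TL L by blast
      ultimately show False using noA[of A] A by simp
    qed
    have fin: "finite (S - L)" using S by simp
    have "ecount E S = ecount E L + ecount E (S - L) + (\<Sum>v\<in>S - L. deg E v L)"
      using ecount_union[OF E L(2) fin] L(1) by (simp add: Un_absorb1)
    moreover have "2 * ecount E L \<le> K * K"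
    proof -
      have "2 * ecount E L \<le> card L * (card L - 1)" by (rule ecount_le_square[OF E L(2)])
      also have "\<dots> \<le> K * K" using cL by (intro mult_le_mono) auto
      finally show ?thesis .
    qed
    moreover have "2 * ecount E (S - L) \<le> (\<Sum>v\<in>S - L. if v \<in> Y then 1 else 2 * a)"
      using low[of "S - L"] fin by (simp add: sum.If_cases Int_def set_diff_eq mult.commute)
    \<comment> \<open>The value 2 s - 3 is one below the assumed density 2 (s - 1). On
      \<open>Y\<close> it arises as 1 + 2 (s - 2). A vertex outside \<open>Y\<close> and
      \<open>Z\<close> has at most a - 2 neighbours in \<open>L\<close> and contributes at most 2a +
      2 (a - 2) <= 2 s - 4. The extra term for \<open>Z\<close> is bounded in total.\<close>
    moreover have "(\<Sum>v\<in>S - L. (if v \<in> Y then 1 else 2 * a) + 2 * deg E v L) \<le>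
      (\<Sum>v\<in>S - L. (2 * s - 3) + (if v \<in> Z then 2 * K + 2 * a else 0))"
    proof (rule sum_mono)
      fix v assume v: "v \<in> S - L"
      have dv: "deg E v L \<le> K" using deg_le[OF L(2), of E v] cL by simp
      consider "v \<in> Y" | "v \<in> Z" "v \<notin> Y" | "v \<notin> Y" "v \<notin> Z" "card (T v) + 1 < a"
        using v unfolding Y_def Z_def by fastforce
      then show "(if v \<in> Y then 1 else 2 * a) + 2 * deg E v L \<le>
          (2 * s - 3) + (if v \<in> Z then 2 * K + 2 * a else 0)"
      proof cases
        case 1 then show ?thesis using Ydeg[of v] dT[of v] by simp
      next
        case 2 then show ?thesis using dv by simp
      next
        case 3 then show ?thesis using dT[of v] s as' by simp
      qed
    qed
    moreover have "(\<Sum>v\<in>S - L. (2 * s - 3) + (if v \<in> Z then 2 * K + 2 * a else 0)) \<le>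
        (2 * s - 3) * ?n + (2 * K + 2 * a) * (2 ^ K * M0)"
    proof -
      have "(\<Sum>v\<in>S - L. (2 * s - 3) + (if v \<in> Z then 2 * K + 2 * a else 0)) =
          (2 * s - 3) * card (S - L) + (2 * K + 2 * a) * card Z"
        using fin by (simp add: sum.distrib sum.If_cases Int_def Z_def mult.commute)
      also have "\<dots> \<le> (2 * s - 3) * ?n + (2 * K + 2 * a) * (2 ^ K * M0)"
        using S cZ by (intro add_mono mult_le_mono2 card_mono) auto
      finally show ?thesis .
    qed
    ultimately have "2 * ecount E S \<le> K * K + ((2 * s - 3) * ?n + (2 * K + 2 * a) * (2 ^ K * M0))"
      by (simp add: sum.distrib sum_distrib_left)
    with dense have "2 * (s - 1) * ?n \<le> (2 * s - 3) * ?n + (c + K * K + (2 * K + 2 * a) * (2 ^ K * M0))"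
      by linarith
    moreover have "2 * (s - 1) * ?n = (2 * s - 3) * ?n + ?n"
    proof -
      have "2 * (s - 1) = (2 * s - 3) + 1" using s a1 as' by simp
      then show ?thesis by (simp only: add_mult_distrib mult_1)
    qed
    ultimately have "?n \<le> c + K * K + (2 * K + 2 * a) * (2 ^ K * M0)" by linarith
    then show False using nN unfolding N_def by linarith
  qed
  show ?thesis using main unfolding s_def by (intro exI[of _ N]) blast
qed

section \<open>The graph around a complete core\<close>

text \<open>The core \<open>A\<close> is exactly one vertex too small for packing all paths
  alternately, so saving a single core vertex on one path is already contradictory. The bound
  \<open>cW\<close> covers one arbitrary path together with the \<open>W\<close>-vertices of all
  others.\<close>

locale complete_core =
  fixes E :: "'a set set" and S A :: "'a set" and I :: "'i set" and m :: "'i \<Rightarrow> nat"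
  assumes E: "edge_set E" and S: "finite S" and AS: "A \<subseteq> S"
    and I: "finite I" "card I \<ge> 2" and m2: "\<And>i. i \<in> I \<Longrightarrow> m i \<ge> 2"
    and cA: "card A + 1 = (\<Sum>i\<in>I. m i div 2)"
    and cW: "(\<Sum>i\<in>I. m i + 1) \<le> card (common_nbrs E A (S - A))"
    and free: "\<not> packs E S I m"
begin

definition W :: "'a set" where "W = common_nbrs E A (S - A)"

text \<open>Such an edge is the one that may exceed |A| edges per outer vertex. Both its ends see
  the whole core, so it can also serve as an edge of \<open>F\<close>.\<close>

definition full_edge :: "'a set \<Rightarrow> bool" where
  "full_edge T \<longleftrightarrow> (\<exists>x\<in>T \<inter> W. \<exists>y\<in>T \<inter> W. adj E x y)"

lemma finA: "finite A" and finW: "finite W"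
  using AS S finite_subset by (auto simp: W_def common_nbrs_def)

lemma W_sub: "W \<subseteq> S - A" "A \<inter> W = {}" and W_adj: "a \<in> A \<Longrightarrow> w \<in> W \<Longrightarrow> adj E a w"
  by (auto simp: W_def common_nbrs_def)

lemma half_le: "i \<in> I \<Longrightarrow> m i div 2 \<le> card A + 1"
  using member_le_sum[of i I "\<lambda>i. m i div 2"] I cA by simp

lemma path_le_W: "i \<in> I \<Longrightarrow> m i + 1 \<le> card W"
  using member_le_sum[of i I "\<lambda>i. m i + 1"] I cW unfolding W_def by simp

text \<open>The other paths need |A| + 1 - l_i core vertices in total, where l_i is half of
  \<open>m i\<close> rounded down, and at least |A| - (l_i - 1) are left.\<close>

lemma cheap_path:
  assumes "i \<in> I" "is_path E p" "set p \<subseteq> S" "length p = m i" "card (set p \<inter> A) < m i div 2"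
  shows False
proof -
  let ?l = "\<lambda>i. m i div 2"
  have I': "I = insert i (I - {i})" using assms(1) by auto
  have sum_split: "(\<Sum>j\<in>I. g j) = g i + (\<Sum>j\<in>I - {i}. g j)" for g :: "'i \<Rightarrow> nat"
    using sum.remove[OF I(1) assms(1)] .
  have cp: "card (set p) \<le> m i" using assms(4) card_length by metis
  have "packs E ((A - set p) \<union> (W - set p)) (I - {i}) (\<lambda>j. 2 * ?l j + 1)"
  proof (rule packs_bipartite)
    have "card (A - set p) = card A - card (set p \<inter> A)"
      using finA by (simp add: card_Diff_subset_Int Int_commute)
    then show "sum ?l (I - {i}) \<le> card (A - set p)"
      using cA assms(5) sum_split[of ?l] by linarith
    have "card W - card (set p) \<le> card (W - set p)" by (intro diff_card_le_card_Diff) simp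
    moreover have "(\<Sum>j\<in>I - {i}. ?l j + 1) \<le> (\<Sum>j\<in>I - {i}. m j + 1)" by (intro sum_mono) simp
    ultimately show "(\<Sum>j\<in>I - {i}. ?l j + 1) \<le> card (W - set p)"
      using cW cp sum_split[of "\<lambda>j. m j + 1"] unfolding W_def by linarith
  qed (use I finA finW W_sub W_adj in \<open>auto simp: common_nbrs_def\<close>)
  then have "packs E (S - set p) (I - {i}) m"
    by (rule packs_mono) (use W_sub AS in auto)
  then have "packs E S (insert i (I - {i})) m" using assms by (intro packs_insert) auto
  then show False using free I' by simp
qed

text \<open>A start that wastes no core vertices is completed by r core vertices, \<open>a\<close>
  first, each followed by a vertex of \<open>W\<close>. Enough of the core is available by
  \<open>half_le\<close>.\<close>

lemma cheap_extension:
  assumes "i \<in> I" "is_path E p" "p \<noteq> []" "set p \<subseteq> S" "a \<in> A" "a \<notin> set p" "adj E (last p) a"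
    "length p + 2 * r = m i" "r \<ge> 1" "card (set p \<inter> A) + r < m i div 2"
  shows False
proof -
  have "card (A - set p) = card A - card (set p \<inter> A)"
    using finA by (simp add: card_Diff_subset_Int Int_commute)
  moreover have "card (A - set p - {a}) = card (A - set p) - 1" using assms by simp
  ultimately have "r - 1 \<le> card (A - set p - {a})" using half_le[OF assms(1)] assms(10) by linarith
  then obtain B where B: "B \<subseteq> A - set p - {a}" "card B = r - 1" "finite B"
    by (meson obtain_subset_with_card_n)
  obtain bs where bs: "set bs = B" "distinct bs" using B finite_distinct_list by blast
  have lbs: "length (a # bs) = r" using bs B distinct_card[of bs] assms(9) by simp
  have "card W - card (set p) \<le> card (W - set p)" by (intro diff_card_le_card_Diff) simp
  then have "length (a # bs) \<le> card (W - set p)"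
    using path_le_W[OF assms(1)] card_length[of p] assms(8) lbs by linarith
  moreover have "set (a # bs) \<inter> set p = {}" using bs B assms by auto
  moreover have "(W - set p) \<inter> set (a # bs) = {}" using bs B assms W_sub by auto
  moreover have "distinct (a # bs)" using bs B by auto
  moreover have "adj E x w" if "x \<in> set (a # bs)" "w \<in> W - set p" for x w
    using that bs B assms W_adj by auto
  ultimately obtain q where q: "is_path E (p @ q)" "length q = 2 * length (a # bs)"
    "set q \<subseteq> set (a # bs) \<union> (W - set p)"
    using alternating_extension[of E p "a # bs" "W - set p" thesis] assms(2,3,7) finW
    by (auto simp del: list.set distinct.simps list.size)
  show False
  proof (rule cheap_path[OF assms(1) q(1)])
    have "set q \<subseteq> A \<union> W" using q(3) bs B assms(5) by auto
    then show "set (p @ q) \<subseteq> S" using assms(4) W_sub AS by auto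
    show "length (p @ q) = m i" using q lbs assms by simp
    have "set (p @ q) \<inter> A \<subseteq> (set p \<inter> A) \<union> set (a # bs)" using q W_sub by auto
    then have "card (set (p @ q) \<inter> A) \<le> card ((set p \<inter> A) \<union> set (a # bs))" by (intro card_mono) auto
    also have "\<dots> \<le> card (set p \<inter> A) + r"
      using card_Un_le card_length[of "a # bs"] lbs by (metis add_left_mono order.trans)
    finally show "card (set (p @ q) \<inter> A) < m i div 2" using assms(10) by linarith
  qed
qed

text \<open>Two outer vertices in front of an alternating path: only m/2 - 1 core vertices are used.
  Order at least 4 ensures that the path really enters the core.\<close>

lemma even_no_edge:
  assumes "i \<in> I" "even (m i)" "m i \<ge> 4" "v \<in> S - A" "y \<in> S - A" "adj E y v" "a \<in> A" "adj E v a"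
  shows False
proof (rule cheap_extension[of i "[y, v]" a "m i div 2 - 1"])
  show "is_path E [y, v]" using assms adj_neq[OF E] by (auto simp: is_path_def)
  have "set [y, v] \<inter> A = {}" using assms by auto
  then show "card (set [y, v] \<inter> A) + (m i div 2 - 1) < m i div 2" using assms by simp
qed (use assms in auto)

text \<open>For odd order a single outer edge saves nothing over an alternating path that starts and
  ends outside; three consecutive outer vertices save one core vertex.\<close>

lemma odd_no_P3:
  assumes "i \<in> I" "odd (m i)" "m i \<ge> 5" "v \<in> S - A" "y \<in> S - A" "z \<in> S - A" "adj E z y" "adj E y v"
    "z \<noteq> v" "a \<in> A" "adj E v a"
  shows False
proof (rule cheap_extension[of i "[z, y, v]" a "m i div 2 - 1"])
  show "is_path E [z, y, v]" using assms adj_neq[OF E] by (auto simp: is_path_def)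
  have "set [z, y, v] \<inter> A = {}" using assms by auto
  then show "card (set [z, y, v] \<inter> A) + (m i div 2 - 1) < m i div 2" using assms by simp
  show "length [z, y, v] + 2 * (m i div 2 - 1) = m i" using assms(2,3) by (auto elim!: oddE)
qed (use assms in auto)

text \<open>Two disjoint edges in \<open>W\<close>, linked through one core vertex, give five path
  vertices for the price of one core vertex instead of two. Longer paths continue through a second
  core vertex \<open>b\<close>.\<close>

lemma odd_no_2P2:
  assumes "i \<in> I" "odd (m i)" "m i \<ge> 5" "x \<in> W" "y \<in> W" "x' \<in> W" "y' \<in> W" "adj E x y" "adj E x' y'"
    "{x, y} \<inter> {x', y'} = {}"
  shows False
proof -
  have "A \<noteq> {}" using half_le[OF assms(1)] assms(3) by auto
  then obtain a where a: "a \<in> A" by blast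
  let ?p = "[y, x, a, x', y']"
  have nA: "x \<notin> A" "y \<notin> A" "x' \<notin> A" "y' \<notin> A" using assms W_sub by auto
  have p: "is_path E ?p" "set ?p \<subseteq> S"
    using assms a nA adj_neq[OF E] W_adj adj_sym[of E] W_sub AS by (auto simp: is_path_def)
  have pA: "set ?p \<inter> A = {a}" using a nA by auto
  show False
  proof (cases "m i = 5")
    case True
    then show False using cheap_path[OF assms(1) p] pA by simp
  next
    case False
    then have m7: "m i \<ge> 7" using assms(2,3) by presburger
    then have "card A \<ge> 2" using half_le[OF assms(1)] by linarith
    then have "\<not> A \<subseteq> {a}" using card_mono[of "{a}" A] by auto
    then obtain b where b: "b \<in> A" "b \<noteq> a" by blast
    obtain h where "m i = 2 * h + 1" using assms(2) by (rule oddE)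
    with m7 have hb: "length ?p + 2 * (m i div 2 - 2) = m i" "m i div 2 - 2 \<ge> 1"
      "card (set ?p \<inter> A) + (m i div 2 - 2) < m i div 2"
      unfolding pA by auto
    have bp: "b \<notin> set ?p" using b nA by auto
    have "adj E (last ?p) b" using W_adj[OF b(1) assms(7)] adj_sym[of E b y'] by simp
    then show False
      by (rule cheap_extension[OF assms(1) p(1) list.distinct(2) p(2) b(1) bp _ hb])
  qed
qed

text \<open>Without edges to the core, all degrees inside \<open>T\<close> are at least |A| + 1,
  which is at least twice the smallest half-length since there are two or more paths. Erdos-Gallai
  then yields a path for that component avoiding the core entirely.\<close>

lemma dense_meets_core:
  assumes "T \<subseteq> S - A" "T \<noteq> {}" "\<And>v. v \<in> T \<Longrightarrow> card A < deg E v T + deg E v A"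
  obtains v a where "v \<in> T" "a \<in> A" "adj E v a"
proof (rule ccontr)
  assume "\<not> thesis"
  then have none: "\<not> adj E v a" if "v \<in> T" "a \<in> A" for v a using that \<open>\<And>v a. v \<in> T \<Longrightarrow> a \<in> A \<Longrightarrow> adj E v a \<Longrightarrow> thesis\<close> by blast
  let ?l = "\<lambda>i. m i div 2"
  have fT: "finite T" using assms(1) S finite_subset by blast
  have "I \<noteq> {}" using I by auto
  then obtain i where i: "i \<in> I" "\<And>j. j \<in> I \<Longrightarrow> ?l i \<le> ?l j"
    using ex_is_arg_min_if_finite[OF I(1), of ?l] by (auto simp: is_arg_min_linorder)
  have "2 * ?l i \<le> (\<Sum>j\<in>I. ?l i)" using I by (simp add: mult_le_mono1)
  also have "\<dots> \<le> (\<Sum>j\<in>I. ?l j)" using i by (intro sum_mono) auto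
  finally have min: "2 * ?l i \<le> card A + 1" using cA by simp
  have l1: "?l i \<ge> 1" using m2[OF i(1)] by simp
  have "2 * ecount E T \<le> (2 * ?l i + 1 - 2) * card T"
  proof (rule erdos_gallai[OF E fT])
    fix p assume p: "is_path E p" "set p \<subseteq> T"
    show "length p \<noteq> 2 * ?l i + 1"
    proof
      assume len: "length p = 2 * ?l i + 1"
      have sub: "set (take (m i) p) \<subseteq> T" using p set_take_subset by fast
      then have "set (take (m i) p) \<inter> A = {}" using assms(1) by auto
      moreover have "length (take (m i) p) = m i" using len by auto
      ultimately show False
        using cheap_path[OF i(1) is_path_take[OF p(1), of "m i"]] sub assms(1) l1 by auto
    qed
  qed (use l1 in simp)
  moreover have "(card A + 1) * card T \<le> 2 * ecount E T"
  proof -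
    have "deg E v A = 0" if "v \<in> T" for v
    proof -
      have "{u \<in> A. adj E v u} = {}" using none[OF that] by blast
      then show ?thesis unfolding deg_def by (metis card.empty)
    qed
    then have "(\<Sum>v\<in>T. card A + 1) \<le> (\<Sum>v\<in>T. deg E v T)" using assms(3) by (intro sum_mono) force
    then show ?thesis using handshake[OF E fT] by (simp add: mult.commute)
  qed
  moreover have "0 < card T" using assms fT by (simp add: card_gt_0_iff)
  moreover have "(2 * ?l i + 1 - 2) * card T + card T \<le> (card A + 1) * card T"
  proof -
    have "(2 * ?l i + 1 - 2) + 1 \<le> card A + 1" using min l1 by simp
    then have "((2 * ?l i + 1 - 2) + 1) * card T \<le> (card A + 1) * card T" by (rule mult_le_mono1)
    then show ?thesis by simp
  qed
  ultimately show False by linarith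
qed

text \<open>Peel off vertices carrying at most |A| edges to \<open>T\<close> and the core. If none
  is left to peel, \<open>dense_meets_core\<close> leads to an isolated edge of \<open>T\<close>
  whose ends both see all of \<open>A\<close>; removing it costs one edge too many, and
  \<open>odd_no_2P2\<close> forbids this from happening twice.\<close>

lemma outer_edges:
  assumes ok: "(\<exists>i\<in>I. even (m i) \<and> m i \<ge> 4) \<or> (\<exists>i\<in>I. odd (m i) \<and> m i \<ge> 5)"
  assumes "T \<subseteq> S - A"
  shows "ecount E T + (\<Sum>v\<in>T. deg E v A) \<le> card A * card T + (if full_edge T then 1 else 0)"
  using assms(2)
proof (induction "card T" arbitrary: T rule: less_induct)
  case less
  have fT: "finite T" using less.prems S finite_subset by blast
  consider (empty) "T = {}" | (low) v where "v \<in> T" "deg E v T + deg E v A \<le> card A"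
    | (dense) "T \<noteq> {}" "\<And>v. v \<in> T \<Longrightarrow> card A < deg E v T + deg E v A"
    using not_le by blast
  then show ?case
  proof cases
    case empty
    then show ?thesis using E by simp
  next
    case low
    have "ecount E T = ecount E (T - {v}) + deg E v (T - {v})"
      using ecount_insert[OF E, of "T - {v}" v] fT low by (simp add: insert_absorb)
    moreover have "deg E v (T - {v}) \<le> deg E v T" using fT by (intro deg_mono) auto
    moreover have "(\<Sum>v\<in>T. deg E v A) = deg E v A + (\<Sum>v\<in>T - {v}. deg E v A)"
      using fT low by (simp add: sum.remove)
    moreover have "ecount E (T - {v}) + (\<Sum>v\<in>T - {v}. deg E v A) \<le>
        card A * card (T - {v}) + (if full_edge (T - {v}) then 1 else 0)"
      using low less.prems fT by (intro less.hyps psubset_card_mono) auto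
    moreover have "full_edge (T - {v}) \<Longrightarrow> full_edge T" by (auto simp: full_edge_def)
    moreover have "card A * card T = card A + card A * card (T - {v})"
    proof -
      have "card T = Suc (card (T - {v}))" using low fT by (metis card_Suc_Diff1)
      then show ?thesis by simp
    qed
    ultimately show ?thesis using low(2) by (auto split: if_splits)
  next
    case dense
    obtain v a where v: "v \<in> T" "a \<in> A" "adj E v a"
      using dense_meets_core[OF less.prems dense] .
    have dA: "deg E x A \<le> card A" for x by (rule deg_le[OF finA])
    have nbr: "\<exists>y\<in>T. adj E x y" if "x \<in> T" for x
    proof (rule ccontr)
      assume "\<not> ?thesis"
      then have "{u \<in> T. adj E x u} = {}" by blast
      then have "deg E x T = 0" unfolding deg_def by (metis card.empty)
      then show False using dense(2)[OF that] dA[of x] by simp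
    qed
    obtain y where y: "y \<in> T" "adj E v y" using nbr v by blast
    have not_even: "\<not> (\<exists>i\<in>I. even (m i) \<and> m i \<ge> 4)"
      using even_no_edge[of _ v y a] v y less.prems adj_sym[of E] by blast
    then obtain j where j: "j \<in> I" "odd (m j)" "m j \<ge> 5" using ok by blast
    \<comment> \<open>A second neighbour of x in \<open>T\<close> would complete an outer P3 ending
      at x', next to the core. With only one neighbour in \<open>T\<close>, density forces x to see
      all of \<open>A\<close>.\<close>
    have unique: "deg E x T = 1 \<and> x \<in> W"
      if "x \<in> T" "x' \<in> T" "adj E x x'" "b \<in> A" "adj E x' b" for x x' b
    proof -
      have "{u \<in> T. adj E x u} = {x'}"
      proof -
        have "z = x'" if "z \<in> T" "adj E x z" for z
          using odd_no_P3[OF j, of x' x z b] \<open>x \<in> T\<close> \<open>x' \<in> T\<close> \<open>adj E x x'\<close> \<open>b \<in> A\<close> \<open>adj E x' b\<close>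
            that less.prems adj_sym[of E] by blast
        then show ?thesis using that by blast
      qed
      then have d1: "deg E x T = 1" unfolding deg_def by simp
      then have "card A \<le> card {u \<in> A. adj E x u}" using dense(2)[OF that(1)] unfolding deg_def by simp
      then have "{u \<in> A. adj E x u} = A" using finA by (intro card_seteq) auto
      then have "x \<in> W" using that(1) less.prems adj_sym[of E] unfolding W_def common_nbrs_def by blast
      with d1 show ?thesis by blast
    qed
    \<comment> \<open>The order matters: v sees the core, which puts y into \<open>W\<close>; then y
      sees the core, which puts v into \<open>W\<close>.\<close>
    have yW: "deg E y T = 1" "y \<in> W" using unique[of y v a] v y adj_sym[of E] by blast+
    have vW: "deg E v T = 1" "v \<in> W"
      using unique[of v y a] W_adj[OF v(2) yW(2)] v y adj_sym[of E] by blast+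
    have ne: "v \<noteq> y" using y adj_neq[OF E] by blast
    let ?T = "T - {v} - {y}"
    have "deg E y ?T = 0"
    proof -
      have "{u \<in> T. adj E y u} = {v}"
        using yW(1) v y adj_sym[of E] unfolding deg_def
        by (metis (mono_tags, lifting) card_1_singletonE mem_Collect_eq singletonD)
      then have "{u \<in> ?T. adj E y u} = {}" by blast
      then show ?thesis unfolding deg_def by (metis card.empty)
    qed
    moreover have "ecount E (T - {v}) = ecount E ?T + deg E y ?T"
      using ecount_insert[OF E, of ?T y] fT y ne by (simp add: insert_absorb)
    moreover have "ecount E T = ecount E (T - {v}) + deg E v (T - {v})"
      using ecount_insert[OF E, of "T - {v}" v] fT v by (simp add: insert_absorb)
    moreover have "deg E v (T - {v}) \<le> 1" using deg_mono[OF fT, of "T - {v}" E v] vW by simp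
    moreover have "(\<Sum>x\<in>T. deg E x A) = deg E v A + (deg E y A + (\<Sum>x\<in>?T. deg E x A))"
    proof -
      have "(\<Sum>x\<in>T. deg E x A) = deg E v A + (\<Sum>x\<in>T - {v}. deg E x A)"
        by (rule sum.remove[OF fT v(1)])
      moreover have "(\<Sum>x\<in>T - {v}. deg E x A) = deg E y A + (\<Sum>x\<in>?T. deg E x A)"
        by (rule sum.remove) (use fT y ne in auto)
      ultimately show ?thesis by linarith
    qed
    moreover have "ecount E ?T + (\<Sum>x\<in>?T. deg E x A) \<le>
        card A * card ?T + (if full_edge ?T then 1 else 0)"
      by (rule less.hyps) (use v less.prems fT in \<open>auto intro!: psubset_card_mono\<close>)
    moreover have "\<not> full_edge ?T"
    proof
      assume "full_edge ?T"
      then obtain x' y' where "x' \<in> ?T" "x' \<in> W" "y' \<in> ?T" "y' \<in> W" "adj E x' y'"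
        unfolding full_edge_def by blast
      then show False by (intro odd_no_2P2[OF j vW(2) yW(2), of x' y']) (use y in auto)
    qed
    moreover have "full_edge T"
      unfolding full_edge_def by (rule bexI[of _ v], rule bexI[of _ y]) (use v y vW yW in auto)
    moreover have "card A * card T = card A + card A + card A * card ?T"
    proof -
      have "card T = Suc (card (T - {v}))" by (rule card_Suc_Diff1[OF fT v(1), symmetric])
      moreover have "card (T - {v}) = Suc (card ?T)"
        by (rule card_Suc_Diff1[symmetric]) (use fT y ne in auto)
      ultimately have "card T = Suc (Suc (card ?T))" by linarith
      then show ?thesis by (simp only: mult_Suc_right add.assoc)
    qed
    ultimately have "ecount E T + (\<Sum>x\<in>T. deg E x A) \<le> card A * card T + 1"
      using dA[of v] dA[of y] unfolding if_not_P[OF \<open>\<not> full_edge ?T\<close>] by linarith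
    then show ?thesis using \<open>full_edge T\<close> by simp
  qed
qed

lemma edges_le:
  assumes "(\<exists>i\<in>I. even (m i) \<and> m i \<ge> 4) \<or> (\<exists>i\<in>I. odd (m i) \<and> m i \<ge> 5)"
  shows "ecount E S \<le> ecount E A + card A * (card S - card A) + (if full_edge (S - A) then 1 else 0)"
proof -
  have "ecount E S = ecount E A + ecount E (S - A) + (\<Sum>v\<in>S - A. deg E v A)"
    using ecount_union[OF E finA, of "S - A"] S AS by (simp add: Un_absorb1)
  moreover have "card (S - A) = card S - card A" using AS finA by (simp add: card_Diff_subset)
  ultimately show ?thesis using outer_edges[OF assms, of "S - A"] by simp
qed

lemma even_no_full_edge:
  assumes "i \<in> I" "even (m i)" "m i \<ge> 4"
  shows "\<not> full_edge T"
proof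
  assume "full_edge T"
  then obtain x y where xy: "x \<in> W" "y \<in> W" "adj E x y" by (auto simp: full_edge_def)
  have "A \<noteq> {}" using half_le[OF assms(1)] assms(3) by auto
  then obtain a where "a \<in> A" by blast
  then show False using even_no_edge[OF assms, of y x a] xy W_sub W_adj adj_sym[of E] by blast
qed

end

section \<open>Linear forests, extremal numbers and constructions\<close>

lemma offset_block: "i < k \<Longrightarrow> lf_offset m i + m i \<le> (\<Sum>j<k. m j)"
proof -
  assume "i < k"
  have "lf_offset m i + m i = (\<Sum>j<Suc i. m j)" by (simp add: lf_offset_def)
  also have "\<dots> \<le> (\<Sum>j<k. m j)" using \<open>i < k\<close> by (intro sum_mono2) auto
  finally show ?thesis .
qed

lemma offset_inject:
  assumes "lf_offset m i + r = lf_offset m i' + r'" "r < m i" "r' < m i'"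
  shows "i = i' \<and> r = r'"
proof -
  have "\<not> i < i'" "\<not> i' < i"
    using offset_block[of i i' m] offset_block[of i' i m] assms by (auto simp: lf_offset_def)
  then show ?thesis using assms by auto
qed

text \<open>Concatenating the paths in index order puts path i at exactly the positions of block i,
  so indexing into the concatenation is the embedding.\<close>

lemma contains_linear_forest:
  assumes "packs E V {..<k} m"
  shows "contains (V, E) (linear_forest k m)"
proof -
  obtain P where P: "\<And>i. i < k \<Longrightarrow> is_path E (P i) \<and> length (P i) = m i \<and> set (P i) \<subseteq> V"
    and disj: "\<And>i j. i < k \<Longrightarrow> j < k \<Longrightarrow> i \<noteq> j \<Longrightarrow> set (P i) \<inter> set (P j) = {}"
  proof -
    obtain P where "\<forall>i. i < k \<longrightarrow> is_path E (P i) \<and> length (P i) = m i \<and> set (P i) \<subseteq> V"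
      "\<forall>i. i < k \<longrightarrow> (\<forall>j. j < k \<longrightarrow> i \<noteq> j \<longrightarrow> set (P i) \<inter> set (P j) = {})"
      using assms unfolding packs_def Ball_def lessThan_iff by blast
    then show thesis by (intro that[of P]) blast+
  qed
  define c where "c n = concat (map P [0..<n])" for n
  have c: "length (c n) = (\<Sum>j<n. m j) \<and> distinct (c n) \<and> set (c n) \<subseteq> V \<and>
      (\<forall>i<n. \<forall>r<m i. c n ! (lf_offset m i + r) = P i ! r)" if "n \<le> k" for n
    using that
  proof (induction n)
    case 0
    then show ?case by (simp add: c_def)
  next
    case (Suc n)
    have cS: "c (Suc n) = c n @ P n" by (simp add: c_def)
    have IH: "length (c n) = (\<Sum>j<n. m j)" "distinct (c n)" "set (c n) \<subseteq> V"
      "\<And>i r. i < n \<Longrightarrow> r < m i \<Longrightarrow> c n ! (lf_offset m i + r) = P i ! r" using Suc by auto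
    have "set (P i) \<inter> set (P n) = {}" if "i < n" for i using disj[of i n] that Suc.prems by simp
    then have "set (c n) \<inter> set (P n) = {}" by (auto simp: c_def disjoint_iff)
    moreover have "c (Suc n) ! (lf_offset m i + r) = P i ! r" if "i < Suc n" "r < m i" for i r
    proof (cases "i = n")
      case True
      then show ?thesis unfolding cS using IH(1) by (simp add: lf_offset_def nth_append)
    next
      case False
      then have "i < n" using that by simp
      then show ?thesis
        unfolding cS using IH offset_block[of i n m] that by (simp add: nth_append)
    qed
    ultimately show ?case using IH P[of n] Suc.prems by (simp add: cS is_path_def)
  qed
  show ?thesis unfolding contains_def linear_forest_def verts_def edges_def fst_conv snd_conv
  proof (intro exI[of _ "\<lambda>x. c k ! x"] conjI ballI)
    show "inj_on (\<lambda>x. c k ! x) {0..<\<Sum>j<k. m j}" using c[of k] by (auto intro: inj_on_nth)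
    show "(\<lambda>x. c k ! x) ` {0..<\<Sum>j<k. m j} \<subseteq> V" using c[of k] nth_mem[of _ "c k"] by fastforce
    fix e assume "e \<in> {{lf_offset m i + j, lf_offset m i + j + 1} | i j. i < k \<and> j + 1 < m i}"
    then obtain i j where e: "e = {lf_offset m i + j, lf_offset m i + (j + 1)}" "i < k" "j + 1 < m i"
      by auto
    then have "(\<lambda>x. c k ! x) ` e = {P i ! j, P i ! (j + 1)}"
      using c[of k] by (simp add: image_insert del: add_Suc_right)
    moreover have "adj E (P i ! j) (P i ! (j + 1))"
      using P[OF e(2)] e(3) by (auto simp: is_path_def successively_conv_nth)
    ultimately show "(\<lambda>x. c k ! x) ` e \<in> E" by (simp add: adj_def)
  qed
qed

text \<open>The cases \<open>b = 0\<close> and \<open>b = 1\<close> give two edge-disjoint matchings of the forest; the second one needs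
  all paths to be odd.\<close>

lemma matching_le_cover:
  assumes f: "inj_on f (verts (linear_forest k m))" and A: "finite A"
    and b: "\<And>i j. i < k \<Longrightarrow> j < m i div 2 \<Longrightarrow> 2 * j + b + 1 < m i"
    and cover: "\<And>i j. i < k \<Longrightarrow> j < m i div 2 \<Longrightarrow>
      f ` {lf_offset m i + (2 * j + b), lf_offset m i + (2 * j + b) + 1} \<inter> A \<noteq> {}"
  shows "(\<Sum>i<k. m i div 2) \<le> card A"
proof -
  let ?D = "SIGMA i:{..<k}. {..<m i div 2}"
  have "\<exists>r. r \<in> {2 * j + b, 2 * j + b + 1} \<and> f (lf_offset m i + r) \<in> A" if "i < k" "j < m i div 2" for i j
    using cover[OF that] by auto
  then obtain r where r: "\<And>i j. i < k \<Longrightarrow> j < m i div 2 \<Longrightarrow>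
      r i j \<in> {2 * j + b, 2 * j + b + 1} \<and> f (lf_offset m i + r i j) \<in> A" by metis
  have rm: "r i j < m i" if "i < k" "j < m i div 2" for i j using r[OF that] b[OF that] by auto
  have vert: "lf_offset m i + r i j \<in> verts (linear_forest k m)" if "i < k" "j < m i div 2" for i j
    using offset_block[of i k m] rm[OF that] that by (simp add: linear_forest_def verts_def)
  have "inj_on (\<lambda>(i, j). f (lf_offset m i + r i j)) ?D"
  proof (rule inj_onI, clarify)
    fix i j i' j' assume *: "i < k" "j < m i div 2" "i' < k" "j' < m i' div 2"
      "f (lf_offset m i + r i j) = f (lf_offset m i' + r i' j')"
    then have "lf_offset m i + r i j = lf_offset m i' + r i' j'"
      using inj_onD[OF f] vert by blast
    then have "i = i'" "r i j = r i' j'" using offset_inject[of m] rm * by blast+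
    then show "i = i' \<and> j = j'" using r[of i j] r[of i' j'] * by auto
  qed
  moreover have "(\<lambda>(i, j). f (lf_offset m i + r i j)) ` ?D \<subseteq> A" using r by auto
  ultimately have "card ?D \<le> card A" using A by (rule card_inj_on_le)
  then show ?thesis by simp
qed

lemma wf_graph_edge_set: "wf_graph (V, E) \<Longrightarrow> edge_set E"
  by (fastforce simp: wf_graph_def edge_set_def edges_def)

lemma edge_subset: "wf_graph F \<Longrightarrow> e \<in> edges F \<Longrightarrow> e \<subseteq> verts F"
  by (auto simp: wf_graph_def)

lemma wf_graph_edges: "wf_graph (V, E) \<Longrightarrow> finite V \<and> E \<subseteq> Pow V"
  by (auto simp: wf_graph_def edges_def verts_def)

lemma ecount_wf: "wf_graph (V, E) \<Longrightarrow> ecount E V = card E"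
  using wf_graph_edges[of V E] unfolding ecount_def by (intro arg_cong[of _ _ card]) auto

lemma wf_graphI: "edge_set E \<Longrightarrow> finite V \<Longrightarrow> (\<And>e. e \<in> E \<Longrightarrow> e \<subseteq> V) \<Longrightarrow> wf_graph (V, E)"
  unfolding wf_graph_def edge_set_def edges_def verts_def by fastforce

section \<open>Extremal numbers, and placing F around a core\<close>

lemma ex_least:
  assumes "\<And>E. wf_graph ({0..<n}, E) \<Longrightarrow> \<forall>F\<in>Fs. \<not> contains ({0..<n}, E) F \<Longrightarrow> ereal (card E) \<le> x"
  shows "ex n Fs \<le> x"
  unfolding ex_def using assms by (auto intro!: Sup_least)

lemma ex_upper:
  assumes "wf_graph ({0..<n}, E)" "\<forall>F\<in>Fs. \<not> contains ({0..<n}, E) F"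
  shows "ereal (card E) \<le> ex n Fs"
  unfolding ex_def using assms by (auto intro!: Sup_upper)

text \<open>The supremum ranges over a finite set, so it is a maximum unless no graph is
  admissible.\<close>

lemma ex_attained:
  obtains "ex n Fs = -\<infinity>"
  | E where "wf_graph ({0..<n}, E)" "\<forall>F\<in>Fs. \<not> contains ({0..<n}, E) F" "ex n Fs = ereal (card E)"
proof -
  let ?C = "{E. wf_graph ({0..<n}, E) \<and> (\<forall>F\<in>Fs. \<not> contains ({0..<n}, E) F)}"
  have "?C \<subseteq> Pow (Pow {0..<n})" using wf_graph_edges by blast
  then have fin: "finite ?C" by (rule finite_subset) simp
  have ex: "ex n Fs = Sup ((\<lambda>E. ereal (card E)) ` ?C)"
    unfolding ex_def by (intro arg_cong[of _ _ Sup]) auto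
  show thesis
  proof (cases "?C = {}")
    case True
    then have "ex n Fs = -\<infinity>" unfolding ex True by (simp add: bot_ereal_def)
    then show thesis using that(1) by blast
  next
    case False
    then have "ex n Fs \<in> (\<lambda>E. ereal (card E)) ` ?C"
      unfolding ex using fin by (subst Max_Sup[symmetric]) (auto intro!: Max_in simp del: Collect_empty_eq)
    then show thesis using that(2) by blast
  qed
qed

text \<open>Extremal numbers are defined on initial segments of the naturals, so the graph on
  \<open>A\<close> is relabelled by a bijection.\<close>

lemma ecount_le_ex:
  assumes "edge_set E" "finite A" "card A = s"
    "\<And>F. F \<in> Fs \<Longrightarrow> \<not> contains (A, {e \<in> E. e \<subseteq> A}) F"
  shows "ereal (ecount E A) \<le> ex s Fs"
proof -
  obtain h where h: "bij_betw h A {0..<s}" using ex_bij_betw_finite_nat[OF assms(2)] assms(3) by auto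
  let ?EA = "{e \<in> E. e \<subseteq> A}"
  define Q where "Q = (`) h ` ?EA"
  have inj: "inj_on h A" "h ` A = {0..<s}" using h by (auto simp: bij_betw_def)
  have "inj_on ((`) h) ?EA" using inj_on_image_Pow[OF inj(1)] by (rule inj_on_subset) auto
  then have cQ: "card Q = ecount E A" unfolding Q_def ecount_def by (rule card_image)
  have "wf_graph ({0..<s}, Q)"
  proof (rule wf_graphI)
    show "edge_set Q" unfolding edge_set_def
    proof
      fix e assume "e \<in> Q"
      then obtain e' where e': "e' \<in> E" "e' \<subseteq> A" "e = h ` e'" by (auto simp: Q_def)
      then obtain u v where uv: "u \<noteq> v" "e' = {u, v}" using assms(1) by (auto simp: edge_set_def)
      then have "h u \<noteq> h v" using e' inj(1) by (auto dest: inj_onD)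
      then show "\<exists>u v. u \<noteq> v \<and> e = {u, v}" using uv e' by (intro exI[of _ "h u"] exI[of _ "h v"]) simp
    qed
    show "e \<subseteq> {0..<s}" if "e \<in> Q" for e using that inj(2) unfolding Q_def by blast
  qed simp
  moreover have "\<not> contains ({0..<s}, Q) F" if F: "F \<in> Fs" for F
  proof
    assume "contains ({0..<s}, Q) F"
    then obtain f where f: "inj_on f (verts F)" "f ` verts F \<subseteq> {0..<s}" "\<And>e. e \<in> edges F \<Longrightarrow> f ` e \<in> Q"
      unfolding contains_def by (auto simp: verts_def edges_def)
    let ?g = "inv_into A h"
    have "contains (A, ?EA) F" unfolding contains_def
    proof (intro exI[of _ "?g \<circ> f"] conjI ballI)
      show "inj_on (?g \<circ> f) (verts F)"
        using f(1,2) inj by (intro comp_inj_on inj_on_subset[OF inj_on_inv_into[of "{0..<s}" h A]]) auto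
      show "(?g \<circ> f) ` verts F \<subseteq> verts (A, ?EA)"
        using f(2) inj(2) inv_into_into[of _ h A] by (auto simp: verts_def)
      fix e assume "e \<in> edges F"
      then obtain e' where e': "e' \<in> E" "e' \<subseteq> A" "f ` e = h ` e'" using f(3) unfolding Q_def by blast
      have "(?g \<circ> f) ` e = ?g ` (h ` e')" using e'(3) by (metis image_comp)
      also have "\<dots> = e'" using inv_into_image_cancel[OF inj(1) e'(2)] .
      finally show "(?g \<circ> f) ` e \<in> edges (A, ?EA)" using e' by (simp add: edges_def)
    qed
    then show False using assms(4)[OF F] by blast
  qed
  ultimately show ?thesis using ex_upper[of s Q Fs] cQ by simp
qed

text \<open>The vertices of \<open>R\<close> go to common neighbours of \<open>A\<close> and the
  others into \<open>A\<close>. Edges between the two parts are then automatic; only edges inside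
  \<open>R\<close> have to be supplied.\<close>

lemma core_contains:
  assumes F: "wf_graph F" and AV: "A \<subseteq> V"
    and core: "contains (A, {e \<in> E. e \<subseteq> A}) (induced F (verts F - R))"
    and g: "inj_on g R" "g ` R \<subseteq> common_nbrs E A (V - A)"
      "\<And>e. e \<in> edges F \<Longrightarrow> e \<subseteq> R \<Longrightarrow> g ` e \<in> E"
  shows "contains (V, E) F"
proof -
  obtain f where f: "inj_on f (verts F - R)" "f ` (verts F - R) \<subseteq> A"
      "\<And>e. e \<in> edges F \<Longrightarrow> e \<subseteq> verts F - R \<Longrightarrow> f ` e \<in> E"
    using core unfolding contains_def induced_def by (auto simp: verts_def edges_def)
  define f' where "f' v = (if v \<in> R then g v else f v)" for v
  have gR: "g v \<in> V - A" "a \<in> A \<Longrightarrow> adj E a (g v)" if "v \<in> R" for v a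
    using g(2) that by (auto simp: common_nbrs_def)
  show ?thesis unfolding contains_def
  proof (intro exI[of _ f'] conjI ballI)
    show "inj_on f' (verts F)"
    proof (rule inj_onI)
      fix x y assume xy: "x \<in> verts F" "y \<in> verts F" "f' x = f' y"
      have fA: "f v \<in> A" if "v \<in> verts F" "v \<notin> R" for v using f(2) that by auto
      show "x = y"
        using xy gR(1)[of x] gR(1)[of y] fA[of x] fA[of y] inj_onD[OF g(1), of x y] inj_onD[OF f(1), of x y]
        unfolding f'_def by (auto split: if_splits)
    qed
    show "f' ` verts F \<subseteq> verts (V, E)"
      using f(2) AV gR(1) by (auto simp: f'_def verts_def)
    fix e assume e: "e \<in> edges F"
    then obtain u v where uv: "u \<noteq> v" "e = {u, v}" "u \<in> verts F" "v \<in> verts F"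
      using F by (auto simp: wf_graph_def)
    have fA: "f v \<in> A" if "v \<in> verts F" "v \<notin> R" for v using f(2) that by auto
    consider "u \<in> R" "v \<in> R" | "u \<in> R" "v \<notin> R" | "u \<notin> R" "v \<in> R" | "u \<notin> R" "v \<notin> R" by blast
    then have "f' ` e \<in> E"
    proof cases
      case 1
      then show ?thesis using g(3)[OF e] uv by (simp add: f'_def)
    next
      case 2
      then show ?thesis using gR(2)[OF 2(1) fA[OF uv(4) 2(2)]] uv by (simp add: f'_def adj_def insert_commute)
    next
      case 3
      then show ?thesis using gR(2)[OF 3(2) fA[OF uv(3) 3(1)]] uv by (simp add: f'_def adj_def)
    next
      case 4
      then show ?thesis using f(3)[OF e] uv by (simp add: f'_def)
    qed
    then show "f' ` e \<in> edges (V, E)" by (simp add: edges_def)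
  qed
qed

lemma finite_edges: "wf_graph F \<Longrightarrow> finite (edges F)"
  by (rule finite_subset[of _ "Pow (verts F)"]) (auto simp: wf_graph_def)

lemma core_G1_free:
  assumes F: "wf_graph F" and V: "finite V" "A \<subseteq> V" and free: "\<not> contains (V, E) F"
    and big: "card (verts F) \<le> card (common_nbrs E A (V - A))" and F': "F' \<in> G1 F"
  shows "\<not> contains (A, {e \<in> E. e \<subseteq> A}) F'"
proof
  assume core: "contains (A, {e \<in> E. e \<subseteq> A}) F'"
  obtain R where R: "F' = induced F (verts F - R)" "R \<subseteq> verts F" "num_edges_in F R = 0"
    using F' by (auto simp: G1_def)
  have fV: "finite (verts F)" using F by (simp add: wf_graph_def)
  then have "card R \<le> card (common_nbrs E A (V - A))" using big card_mono[OF fV R(2)] by simp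
  then obtain g where "inj_on g R" "g ` R \<subseteq> common_nbrs E A (V - A)"
    using card_le_inj[of R "common_nbrs E A (V - A)"] R(2) fV V by (auto simp: common_nbrs_def finite_subset)
  moreover have "\<not> e \<subseteq> R" if "e \<in> edges F" for e
    using R(3) finite_edges[OF F] that by (auto simp: num_edges_in_def)
  ultimately show False using core_contains[OF F V(2), of E R g] core R(1) free by blast
qed

text \<open>If the deleted set spans one edge uv, that edge is sent to xy and the remaining deleted
  vertices go to other common neighbours.\<close>

lemma core_G2_free:
  assumes F: "wf_graph F" and V: "finite V" "A \<subseteq> V" and free: "\<not> contains (V, E) F"
    and big: "card (verts F) \<le> card (common_nbrs E A (V - A))" and F': "F' \<in> G2 F"
    and xy: "x \<in> common_nbrs E A (V - A)" "y \<in> common_nbrs E A (V - A)" "adj E x y" "x \<noteq> y"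
  shows "\<not> contains (A, {e \<in> E. e \<subseteq> A}) F'"
proof
  assume core: "contains (A, {e \<in> E. e \<subseteq> A}) F'"
  let ?W = "common_nbrs E A (V - A)"
  obtain R where R: "F' = induced F (verts F - R)" "R \<subseteq> verts F" "num_edges_in F R \<le> 1"
    using F' by (auto simp: G2_def)
  have fV: "finite (verts F)" using F by (simp add: wf_graph_def)
  have fin: "finite R" "finite ?W" using R(2) fV V by (auto simp: common_nbrs_def finite_subset)
  show False
  proof (cases "num_edges_in F R = 0")
    case True
    then have "F' \<in> G1 F" using R by (auto simp: G1_def)
    then show False using core_G1_free[OF F V free big] core by blast
  next
    case False
    then obtain e where e: "{e \<in> edges F. e \<subseteq> R} = {e}"
      using R(3) unfolding num_edges_in_def
      by (metis (no_types, lifting) One_nat_def card_1_singletonE le_antisym not_less_eq_eq le_zero_eq)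
    then have eR: "e \<in> edges F" "e \<subseteq> R" by auto
    obtain u v where "u \<noteq> v" "e = {u, v}" using F eR(1) by (auto simp: wf_graph_def)
    with eR(2) have uv: "u \<noteq> v" "e = {u, v}" "u \<in> R" "v \<in> R" by auto
    have "card R \<le> card ?W" using big card_mono[OF fV R(2)] by simp
    then have "card (R - {u, v}) \<le> card (?W - {x, y})"
      using uv xy fin by (simp add: card_Diff_subset)
    then obtain g where g: "inj_on g (R - {u, v})" "g ` (R - {u, v}) \<subseteq> ?W - {x, y}"
      using card_le_inj[of "R - {u, v}" "?W - {x, y}"] fin by auto
    let ?g = "g(u := x, v := y)"
    have "inj_on ?g R"
    proof (rule inj_onI)
      fix a b assume ab: "a \<in> R" "b \<in> R" "?g a = ?g b"
      have gx: "g r \<noteq> x \<and> g r \<noteq> y" if "r \<in> R - {u, v}" for r using g(2) that by blast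
      show "a = b"
        using ab gx[of a] gx[of b] uv(1) xy(4) inj_onD[OF g(1), of a b]
        by (cases "a \<in> {u, v}"; cases "b \<in> {u, v}") auto
    qed
    moreover have "?g ` R \<subseteq> ?W" using g xy by (auto simp: image_subset_iff)
    moreover have "?g ` e' \<in> E" if "e' \<in> edges F" "e' \<subseteq> R" for e'
    proof -
      have "e' = {u, v}" using that e uv(2) by blast
      then show ?thesis using uv(1) xy(3) by (simp add: adj_def)
    qed
    ultimately show False using core_contains[OF F V(2), of E R ?g] core R(1) free by blast
  qed
qed

section \<open>Lower bound: joining a core to an almost edgeless graph\<close>

definition join_graph :: "nat \<Rightarrow> nat \<Rightarrow> nat set set \<Rightarrow> nat set set \<Rightarrow> nat set set" where
  "join_graph s n Q X = Q \<union> {{a, b} | a b. a < s \<and> s \<le> b \<and> b < n} \<union> X"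

locale join =
  fixes s n :: nat and Q X :: "nat set set"
  assumes Q: "wf_graph ({0..<s}, Q)" and X: "wf_graph ({s..<n}, X)" and sn: "s \<le> n"
begin

abbreviation E :: "nat set set" where "E \<equiv> join_graph s n Q X"

lemma in_Q: "e \<in> Q \<Longrightarrow> e \<subseteq> {0..<s} \<and> e \<noteq> {}"
  using wf_graph_edges[OF Q] wf_graph_edge_set[OF Q] by (auto simp: edge_set_def)

lemma in_X: "e \<in> X \<Longrightarrow> e \<subseteq> {s..<n} \<and> e \<noteq> {}"
  using wf_graph_edges[OF X] wf_graph_edge_set[OF X] by (auto simp: edge_set_def)

lemma wf_join: "wf_graph ({0..<n}, E)"
proof (rule wf_graphI)
  show "edge_set E" unfolding edge_set_def
  proof
    fix e assume "e \<in> E"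
    then consider "e \<in> Q" | a b where "e = {a, b}" "a < s" "s \<le> b" | "e \<in> X"
      unfolding join_graph_def by blast
    then show "\<exists>u v. u \<noteq> v \<and> e = {u, v}"
    proof cases
      case 2
      then show ?thesis by (intro exI[of _ a] exI[of _ b]) auto
    qed (use wf_graph_edge_set[OF Q] wf_graph_edge_set[OF X] in \<open>auto simp: edge_set_def\<close>)
  qed
  show "e \<subseteq> {0..<n}" if "e \<in> E" for e
    using that in_Q[of e] in_X[of e] sn unfolding join_graph_def by fastforce
qed simp

lemma inner_edges: "{e \<in> E. e \<subseteq> {0..<s}} = Q"
  using in_Q in_X unfolding join_graph_def by fastforce

lemma outer_edges: "{e \<in> E. e \<subseteq> {s..<n}} = X"
  using in_Q in_X unfolding join_graph_def by fastforce

lemma edge_cases: "e \<in> E \<Longrightarrow> e \<inter> {0..<s} \<noteq> {} \<or> e \<in> X"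
  using in_Q unfolding join_graph_def by fastforce

lemma card_join: "card E = card Q + s * (n - s) + card X"
proof -
  have "card E = ecount E ({0..<s} \<union> {s..<n})"
    using ecount_wf[OF wf_join] sn by (simp add: ivl_disj_un)
  also have "\<dots> = ecount E {0..<s} + ecount E {s..<n} + (\<Sum>b\<in>{s..<n}. deg E b {0..<s})"
    by (rule ecount_union[OF wf_graph_edge_set[OF wf_join]]) auto
  also have "(\<Sum>b\<in>{s..<n}. deg E b {0..<s}) = (\<Sum>b\<in>{s..<n}. s)"
  proof (rule sum.cong)
    fix b assume b: "b \<in> {s..<n}"
    have "adj E u b" if "u < s" for u using that b by (auto simp: adj_def join_graph_def)
    then have "{u \<in> {0..<s}. adj E b u} = {0..<s}" using adj_sym[of E b] by auto
    then show "deg E b {0..<s} = s" by (simp add: deg_def)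
  qed simp
  also have "ecount E {0..<s} = card Q" unfolding ecount_def inner_edges ..
  also have "ecount E {s..<n} = card X" unfolding ecount_def outer_edges ..
  finally show ?thesis by simp
qed

text \<open>The converse direction to \<open>core_contains\<close>: the vertices embedded outside
  the core span at most |X| edges of \<open>F\<close>, and deleting them leaves a graph that sits in
  \<open>Q\<close>.\<close>

lemma contains_core:
  assumes F: "wf_graph F" and "contains ({0..<n}, E) F"
  obtains R where "R \<subseteq> verts F" "num_edges_in F R \<le> card X"
    "contains ({0..<s}, Q) (induced F (verts F - R))"
proof -
  obtain f where f: "inj_on f (verts F)" "f ` verts F \<subseteq> {0..<n}" "\<And>e. e \<in> edges F \<Longrightarrow> f ` e \<in> E"
    using assms(2) unfolding contains_def by (auto simp: verts_def edges_def)
  define R where "R = {v \<in> verts F. s \<le> f v}"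
  have "(`) f ` {e \<in> edges F. e \<subseteq> R} \<subseteq> {e \<in> E. e \<subseteq> {s..<n}}"
    using f(2,3) by (auto simp: R_def subset_iff image_subset_iff)
  then have "(`) f ` {e \<in> edges F. e \<subseteq> R} \<subseteq> X" unfolding outer_edges .
  moreover have "inj_on ((`) f) {e \<in> edges F. e \<subseteq> R}"
    using inj_on_image_Pow[OF f(1)] by (rule inj_on_subset) (use edge_subset[OF F] in auto)
  moreover have "finite X" using wf_graph_edges[OF X] finite_subset by blast
  ultimately have "num_edges_in F R \<le> card X"
    unfolding num_edges_in_def by (intro card_inj_on_le[of "(`) f"])
  moreover have "contains ({0..<s}, Q) (induced F (verts F - R))"
    unfolding contains_def induced_def
  proof (intro exI[of _ f] conjI ballI)
    fix e assume "e \<in> edges (verts F - R, {e \<in> edges F. e \<subseteq> verts F - R})"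
    then have e: "e \<in> edges F" "e \<subseteq> verts F - R" by (auto simp: edges_def)
    then have "f ` e \<in> {e \<in> E. e \<subseteq> {0..<s}}" using f(3) by (auto simp: R_def subset_iff)
    then show "f ` e \<in> edges ({0..<s}, Q)" unfolding inner_edges by (simp add: edges_def)
  qed (use f in \<open>auto simp: R_def verts_def intro: inj_on_subset\<close>)
  ultimately show thesis using that[of R] by (auto simp: R_def)
qed

end

text \<open>Every edge of the join meets the core, while the forest has a matching of s + 1
  edges.\<close>

lemma join_forest_free:
  assumes "join s n Q {}" "(\<Sum>i<k. m i div 2) = s + 1"
  shows "\<not> contains ({0..<n}, join_graph s n Q {}) (linear_forest k m)"
proof
  assume "contains ({0..<n}, join_graph s n Q {}) (linear_forest k m)"
  then obtain f where f: "inj_on f (verts (linear_forest k m))"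
    "\<And>e. e \<in> edges (linear_forest k m) \<Longrightarrow> f ` e \<in> join_graph s n Q {}"
    unfolding contains_def by (auto simp: edges_def)
  have "(\<Sum>i<k. m i div 2) \<le> card {0..<s}"
  proof (rule matching_le_cover[OF f(1), of _ 0])
    fix i j assume ij: "i < k" "j < m i div 2"
    moreover from ij have "2 * j + 1 < m i" by presburger
    ultimately have "{lf_offset m i + 2 * j, lf_offset m i + 2 * j + 1} \<in> edges (linear_forest k m)"
      unfolding linear_forest_def edges_def snd_conv by blast
    from f(2)[OF this] join.edge_cases[OF assms(1)]
    show "f ` {lf_offset m i + (2 * j + 0), lf_offset m i + (2 * j + 0) + 1} \<inter> {0..<s} \<noteq> {}"
      by (metis add_0_right empty_iff)
  qed auto
  then show False using assms(2) by simp
qed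

text \<open>Each of the two matchings has s + 1 edges, so each must use the extra edge x, yet they
  share no edge of the forest.\<close>

lemma join_edge_forest_free:
  assumes "join s n Q {x}" "(\<Sum>i<k. m i div 2) = s + 1" "\<And>i. i < k \<Longrightarrow> odd (m i)"
  shows "\<not> contains ({0..<n}, join_graph s n Q {x}) (linear_forest k m)"
proof
  assume "contains ({0..<n}, join_graph s n Q {x}) (linear_forest k m)"
  then obtain f where f: "inj_on f (verts (linear_forest k m))"
    "\<And>e. e \<in> edges (linear_forest k m) \<Longrightarrow> f ` e \<in> join_graph s n Q {x}"
    unfolding contains_def by (auto simp: edges_def)
  let ?e = "\<lambda>b i j. {lf_offset m i + (2 * j + b), lf_offset m i + (2 * j + b) + 1}"
  have len: "2 * j + b + 1 < m i" if "b \<le> 1" "i < k" "j < m i div 2" for b i j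
    using assms(3)[OF that(2)] that by presburger
  have edge: "?e b i j \<in> edges (linear_forest k m)" if "b \<le> 1" "i < k" "j < m i div 2" for b i j
    using len[OF that] that unfolding linear_forest_def edges_def snd_conv by blast
  have hit: "\<exists>i j. i < k \<and> j < m i div 2 \<and> f ` ?e b i j = x" if b: "b \<le> 1" for b
  proof (rule ccontr)
    assume no: "\<not> ?thesis"
    have "(\<Sum>i<k. m i div 2) \<le> card {0..<s}"
    proof (rule matching_le_cover[OF f(1), of _ b])
      fix i j assume ij: "i < k" "j < m i div 2"
      then show "f ` ?e b i j \<inter> {0..<s} \<noteq> {}"
        using join.edge_cases[OF assms(1) f(2)[OF edge[OF b ij]]] no by blast
    qed (use len b in auto)
    then show False using assms(2) by simp
  qed
  obtain i j where ij: "i < k" "j < m i div 2" "f ` ?e 0 i j = x" using hit[of 0] by auto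
  obtain i' j' where ij': "i' < k" "j' < m i' div 2" "f ` ?e 1 i' j' = x" using hit[of 1] by auto
  have sub: "?e b i j \<subseteq> verts (linear_forest k m)" if "b \<le> 1" "i < k" "j < m i div 2" for b i j
    using len[OF that] offset_block[OF that(2), of m] by (auto simp: linear_forest_def verts_def)
  have im: "f ` ?e 0 i j = f ` ?e 1 i' j'" unfolding ij(3) ij'(3) ..
  have "?e 0 i j = ?e 1 i' j'"
    by (rule iffD1[OF inj_on_image_eq_iff[OF f(1) sub sub] im]) (use ij ij' in simp_all)
  \<comment> \<open>Pairs of consecutive numbers agree only if their smaller members do. One sits at
    an even position in its block, the other at an odd one.\<close>
  then have "lf_offset m i + 2 * j = lf_offset m i' + (2 * j' + 1)"
    unfolding doubleton_eq_iff by auto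
  then have "2 * j = 2 * j' + 1"
    using offset_inject[of m i "2 * j" i' "2 * j' + 1"] len[of 0 i j] len[of 1 i' j'] ij ij' by auto
  then show False by presburger
qed

text \<open>If the rest were edgeless too, the deleted independent set and its complement would be a
  2-colouring of \<open>F\<close>.\<close>

lemma empty_graph_G1_free:
  assumes F: "wf_graph F" "chromatic F \<ge> 3" and F': "F' \<in> G1 F"
  shows "\<not> contains ({0..<s}, {}) F'"
proof
  assume "contains ({0..<s}, {}) F'"
  then have no: "edges F' = {}" by (auto simp: contains_def edges_def)
  obtain R where R: "F' = induced F (verts F - R)" "R \<subseteq> verts F" "num_edges_in F R = 0"
    using F' by (auto simp: G1_def)
  have R0: "\<not> e \<subseteq> R" if "e \<in> edges F" for e
    using R(3) finite_edges[OF F(1)] that by (auto simp: num_edges_in_def)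
  have R1: "\<not> e \<subseteq> verts F - R" if "e \<in> edges F" for e
    using no R(1) that by (auto simp: induced_def edges_def)
  have "chromatic F \<le> 2" unfolding chromatic_def
  proof (rule Least_le, intro exI[of _ "\<lambda>v. if v \<in> R then 0 else 1"] conjI allI impI ballI)
    fix u v assume uv: "{u, v} \<in> edges F" "u \<noteq> v"
    then have "{u, v} \<subseteq> verts F" by (intro edge_subset[OF F(1)])
    then show "(if u \<in> R then 0 else 1::nat) \<noteq> (if v \<in> R then 0 else 1)"
      using R0[OF uv(1)] R1[OF uv(1)] by auto
  qed auto
  then show False using F(2) by simp
qed

section \<open>Combining stability, the core analysis and the constructions\<close>

theorem theorem1p11:
  fixes k :: nat and m :: "nat \<Rightarrow> nat" and F :: graph
  assumes "k \<ge> 2"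
    and "\<forall>i<k. (even (m i) \<and> m i \<ge> 4) \<or> (odd (m i) \<and> m i \<ge> 3)"
    and "\<not> (\<forall>i<k. m i = 3)"
    and "wf_graph F" and "chromatic F \<ge> 3" and "beta1 F \<ge> 2"
  shows "\<exists>N. \<forall>n\<ge>N.
    let H = linear_forest k m; l = (\<Sum>i<k. m i div 2) in
    ((\<exists>i<k. even (m i)) \<longrightarrow>
       ex n {H, F} = ereal (real ((l - 1) * (n - l + 1))) + ex (l - 1) (G1 F)) \<and>
    ((\<forall>i<k. odd (m i)) \<longrightarrow>
       ex n {H, F} = ereal (real ((l - 1) * (n - l + 1))) +
         max (ex (l - 1) (G1 F)) (ex (l - 1) (G2 F) + 1))"
proof -
  define l where "l = (\<Sum>i<k. m i div 2)"
  define s where "s = l - 1"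
  define H where "H = linear_forest k m"
  have m3: "m i \<ge> 3" if "i < k" for i using assms(2) that by fastforce
  have "(\<Sum>i<k. 1) \<le> l"
    unfolding l_def by (intro sum_mono) (use m3 in fastforce)
  then have ls: "l = s + 1" unfolding s_def using assms(1) by simp
  \<comment> \<open>The first summand lets the forest be packed around the core, the second lets
    \<open>F\<close> be embedded there.\<close>
  define M where "M = (\<Sum>i<k. m i + 1) + card (verts F)"
  obtain N where N: "\<And>(E :: nat set set) S. edge_set E \<Longrightarrow> finite S \<Longrightarrow> N \<le> card S \<Longrightarrow>
      \<not> packs E S {..<k} (\<lambda>i. 2 * (m i div 2) + 1) \<Longrightarrow>
      2 * (l - 1) * card S \<le> 2 * ecount E S + 2 * (s * s) \<Longrightarrow>
      \<exists>A\<subseteq>S. card A = l - 1 \<and> M \<le> card (common_nbrs E A (S - A))"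
  proof -
    have "1 \<le> m i div 2" if "i \<in> {..<k}" for i using m3[of i] that by simp
    then have "\<exists>N. \<forall>(E :: nat set set) S. edge_set E \<longrightarrow> finite S \<longrightarrow> N \<le> card S \<longrightarrow>
        \<not> packs E S {..<k} (\<lambda>i. 2 * (m i div 2) + 1) \<longrightarrow>
        2 * (l - 1) * card S \<le> 2 * ecount E S + 2 * (s * s) \<longrightarrow>
        (\<exists>A\<subseteq>S. card A = l - 1 \<and> M \<le> card (common_nbrs E A (S - A)))"
      unfolding l_def using assms(1) by (intro stability) auto
    then show thesis using that by blast
  qed
  \<comment> \<open>Here \<open>H\<close> differing from kP3 enters: if all orders are odd, one of
    them is at least 5.\<close>
  have ok: "(\<exists>i<k. even (m i) \<and> m i \<ge> 4) \<or> (\<exists>i<k. odd (m i) \<and> m i \<ge> 5)"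
  proof (cases "\<exists>i<k. even (m i)")
    case False
    obtain i where i: "i < k" "m i \<noteq> 3" using assms(3) by blast
    then have "odd (m i)" "m i > 3" using False m3[of i] by auto
    then have "m i \<ge> 5" by presburger
    then show ?thesis using i \<open>odd (m i)\<close> by blast
  qed (use assms(2) in blast)
  have ex_G1: "0 \<le> ex s (G1 F)"
  proof -
    have "wf_graph ({0..<s}, {})" by (auto simp: wf_graph_def verts_def edges_def)
    then show ?thesis
      using ex_upper[of s "{}" "G1 F"] empty_graph_G1_free[OF assms(4,5)] by (simp add: zero_ereal_def)
  qed
  have lower1: "ereal (s * (n - s)) + ex s (G1 F) \<le> ex n {H, F}" if n: "n \<ge> s + 2" for n
  proof (cases rule: ex_attained[of s "G1 F"])
    case 1
    then show ?thesis by simp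
  next
    case (2 Q)
    interpret join s n Q "{}"
      using 2(1) n by unfold_locales (auto simp: wf_graph_def verts_def edges_def)
    have "\<not> contains ({0..<n}, join_graph s n Q {}) F"
    proof
      assume "contains ({0..<n}, join_graph s n Q {}) F"
      then obtain R where "R \<subseteq> verts F" "num_edges_in F R \<le> card ({} :: nat set set)"
        "contains ({0..<s}, Q) (induced F (verts F - R))" using contains_core[OF assms(4)] by blast
      moreover from this have "induced F (verts F - R) \<in> G1 F" unfolding G1_def by auto
      ultimately show False using 2(2) by blast
    qed
    moreover have "\<not> contains ({0..<n}, join_graph s n Q {}) H"
      unfolding H_def using ls l_def by (intro join_forest_free join_axioms) simp
    ultimately have "ereal (card (join_graph s n Q {})) \<le> ex n {H, F}"
      by (intro ex_upper wf_join) auto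
    then show ?thesis using card_join 2(3) by (simp add: add.commute)
  qed
  have lower2: "ereal (s * (n - s)) + (ex s (G2 F) + 1) \<le> ex n {H, F}"
    if n: "n \<ge> s + 2" and odd: "\<forall>i<k. odd (m i)" for n
  proof (cases rule: ex_attained[of s "G2 F"])
    \<comment> \<open>The value -\<infinity> does occur: for F = C5 and s >= 2, deleting a set that
      spans one edge can leave two isolated vertices.\<close>
    case 1
    then show ?thesis by simp
  next
    case (2 Q)
    let ?x = "{s, s + 1}"
    have wfx: "wf_graph ({s..<n}, {?x})"
    proof (rule wf_graphI)
      have "s \<noteq> s + 1" by simp
      then show "edge_set {?x}" unfolding edge_set_def by blast
    qed (use n in auto)
    interpret join s n Q "{?x}"
      using 2(1) wfx n by unfold_locales auto
    have "\<not> contains ({0..<n}, join_graph s n Q {?x}) F"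
    proof
      assume "contains ({0..<n}, join_graph s n Q {?x}) F"
      then obtain R where "R \<subseteq> verts F" "num_edges_in F R \<le> card {?x}"
        "contains ({0..<s}, Q) (induced F (verts F - R))" using contains_core[OF assms(4)] by blast
      moreover from this have "induced F (verts F - R) \<in> G2 F" unfolding G2_def by auto
      ultimately show False using 2(2) by blast
    qed
    moreover have "\<not> contains ({0..<n}, join_graph s n Q {?x}) H"
      unfolding H_def using ls l_def odd by (intro join_edge_forest_free join_axioms) auto
    ultimately have "ereal (card (join_graph s n Q {?x})) \<le> ex n {H, F}"
      by (intro ex_upper wf_join) auto
    then show ?thesis using card_join 2(3) by (simp add: ac_simps one_ereal_def)
  qed
  have upper: "ereal (card E) \<le> ereal (s * (n - s)) + ex s (G1 F) \<or>
      (\<forall>i<k. odd (m i)) \<and> ereal (card E) \<le> ereal (s * (n - s)) + (ex s (G2 F) + 1)"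
    if n: "n \<ge> N + s + 2" and wf: "wf_graph ({0..<n}, E)"
      and H: "\<not> contains ({0..<n}, E) H" and F: "\<not> contains ({0..<n}, E) F" for n E
  proof (cases "card E < s * (n - s)")
    case True
    then have "real (card E) \<le> real (s * (n - s))" by (simp only: of_nat_le_iff)
    then have "ereal (card E) \<le> ereal (s * (n - s)) + 0" by (simp only: ereal_less_eq add_0_right)
    also have "\<dots> \<le> ereal (s * (n - s)) + ex s (G1 F)" using ex_G1 by (rule add_left_mono)
    finally show ?thesis by blast
  next
    case False
    have edge_set: "edge_set E" using wf wf_graph_edge_set by blast
    have no: "\<not> packs E {0..<n} {..<k} m" using H contains_linear_forest unfolding H_def by blast
    \<comment> \<open>Lengthening the even paths by one vertex gives a larger forest, so freeness
      carries over to the all-odd forest of the stability result.\<close>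
    have no': "\<not> packs E {0..<n} {..<k} (\<lambda>i. 2 * (m i div 2) + 1)"
    proof
      assume "packs E {0..<n} {..<k} (\<lambda>i. 2 * (m i div 2) + 1)"
      then have "packs E {0..<n} {..<k} m" by (rule packs_mono) auto
      then show False using no by blast
    qed
    \<comment> \<open>The difference s^2 between s n and s (n - s) is the slack allowed in the
      density hypothesis of stability.\<close>
    have "s * n = s * (n - s) + s * s" using n by (simp add: diff_mult_distrib2)
    then have "2 * (l - 1) * card {0..<n} \<le> 2 * ecount E {0..<n} + 2 * (s * s)"
      using False ecount_wf[OF wf] ls by simp
    then obtain A where A: "A \<subseteq> {0..<n}" "card A = s" "M \<le> card (common_nbrs E A ({0..<n} - A))"
      using N[OF edge_set _ _ no'] n ls by auto
    interpret complete_core E "{0..<n}" A "{..<k}" m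
    proof
      show "2 \<le> m i" if "i \<in> {..<k}" for i using m3[of i] that by simp
    qed (use edge_set A assms(1) ls no in \<open>auto simp: M_def l_def\<close>)
    have big: "card (verts F) \<le> card (common_nbrs E A ({0..<n} - A))" using A(3) by (simp add: M_def)
    have fin: "finite A" using A(1) finite_subset by blast
    have le: "card E \<le> ecount E A + s * (n - s) + (if full_edge ({0..<n} - A) then 1 else 0)"
    proof -
      have "(\<exists>i\<in>{..<k}. even (m i) \<and> m i \<ge> 4) \<or> (\<exists>i\<in>{..<k}. odd (m i) \<and> m i \<ge> 5)"
        using ok by blast
      from edges_le[OF this] show ?thesis unfolding ecount_wf[OF wf] A(2) by simp
    qed
    show ?thesis
    proof (cases "full_edge ({0..<n} - A)")
      case True
      then have odd: "\<forall>i<k. odd (m i)" using even_no_full_edge assms(2) by blast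
      obtain x y where xy: "x \<in> common_nbrs E A ({0..<n} - A)" "y \<in> common_nbrs E A ({0..<n} - A)" "adj E x y"
        using True unfolding full_edge_def W_def by blast
      have "\<not> contains (A, {e \<in> E. e \<subseteq> A}) F'" if "F' \<in> G2 F" for F'
        using core_G2_free[OF assms(4) _ A(1) F big that xy] adj_neq[OF edge_set xy(3)] by blast
      then have "ereal (ecount E A) \<le> ex s (G2 F)" using ecount_le_ex[OF edge_set fin A(2)] by blast
      then have "ereal (s * (n - s)) + (ereal (ecount E A) + 1) \<le> ereal (s * (n - s)) + (ex s (G2 F) + 1)"
        by (intro add_left_mono add_right_mono)
      moreover have "ereal (card E) \<le> ereal (s * (n - s)) + (ereal (ecount E A) + 1)"
      proof -
        have "real (card E) \<le> real (ecount E A + s * (n - s) + 1)"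
          unfolding of_nat_le_iff using le True by simp
        then show ?thesis by (simp add: one_ereal_def)
      qed
      ultimately show ?thesis using odd order.trans by blast
    next
      case False
      have "\<not> contains (A, {e \<in> E. e \<subseteq> A}) F'" if "F' \<in> G1 F" for F'
        using core_G1_free[OF assms(4) _ A(1) F big that] by blast
      then have "ereal (ecount E A) \<le> ex s (G1 F)" using ecount_le_ex[OF edge_set fin A(2)] by blast
      then have "ereal (s * (n - s)) + ereal (ecount E A) \<le> ereal (s * (n - s)) + ex s (G1 F)"
        by (intro add_left_mono)
      moreover have "ereal (card E) \<le> ereal (s * (n - s)) + ereal (ecount E A)"
      proof -
        have "real (card E) \<le> real (ecount E A + s * (n - s))"
          unfolding of_nat_le_iff using le False by simp
        then show ?thesis by simp
      qed
      ultimately show ?thesis using order.trans by blast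
    qed
  qed
  have "((\<exists>i<k. even (m i)) \<longrightarrow> ex n {H, F} = ereal (s * (n - l + 1)) + ex s (G1 F)) \<and>
      ((\<forall>i<k. odd (m i)) \<longrightarrow>
        ex n {H, F} = ereal (s * (n - l + 1)) + max (ex s (G1 F)) (ex s (G2 F) + 1))"
    if n: "n \<ge> N + s + 2" for n
  proof -
    \<comment> \<open>This uses l <= n, which keeps the natural subtraction from being
      truncated.\<close>
    have ns: "n - l + 1 = n - s" using n ls by simp
    show ?thesis unfolding ns
    proof (intro conjI impI)
      have n2: "n \<ge> s + 2" using n by simp
      {
        assume even: "\<exists>i<k. even (m i)"
        have "ex n {H, F} \<le> ereal (s * (n - s)) + ex s (G1 F)"
          by (rule ex_least) (use upper[OF n] even in auto)
        then show "ex n {H, F} = ereal (s * (n - s)) + ex s (G1 F)"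
          using lower1[OF n2] by (rule antisym)
      next
        assume odd: "\<forall>i<k. odd (m i)"
        let ?x = "ereal (s * (n - s))"
        have "?x + ex s (G1 F) \<le> ?x + max (ex s (G1 F)) (ex s (G2 F) + 1)"
          "?x + (ex s (G2 F) + 1) \<le> ?x + max (ex s (G1 F)) (ex s (G2 F) + 1)"
          by (intro add_left_mono max.cobounded1 max.cobounded2)+
        then have "ex n {H, F} \<le> ?x + max (ex s (G1 F)) (ex s (G2 F) + 1)"
          by (intro ex_least) (use upper[OF n] order.trans in blast)
        moreover have "?x + max (ex s (G1 F)) (ex s (G2 F) + 1) \<le> ex n {H, F}"
          using lower1[OF n2] lower2[OF n2 odd] unfolding max_def by simp
        ultimately show "ex n {H, F} = ?x + max (ex s (G1 F)) (ex s (G2 F) + 1)"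
          by (rule antisym)
      }
    qed
  qed
  then show ?thesis
    unfolding Let_def l_def[symmetric] H_def[symmetric] s_def[symmetric]
    by (intro exI[of _ "N + s + 2"] allI impI)
qed

end
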